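(* Let $(R,\mathfrak{m})$ be a local Noetherian ring of Krull dimension $d\geq 2$ whose residue field is finite. Then for each positive integer $n$ there is an ideal of $R$ that is minimally generated by $n$ elements and does not have a proper reduction. If moreover $n\geq d$, this ideal can be chosen to be $\mathfrak{m}$-primary.
   Context: A reduction of an ideal $I$ is an ideal $J\subseteq I$ such that $I^{m+1}=JI^m$ for some $m>0$; it is proper if $J\neq I$. *)

theory Defs
  imports "HOL-Algebra.Algebra" "HOL-Library.Extended_Nat"
begin

fun ideal_pow :: "('a, 'b) ring_scheme \<Rightarrow> 'a set \<Rightarrow> nat \<Rightarrow> 'a set" where
  "ideal_pow R I 0 = carrier R"
| "ideal_pow R I (Suc k) = ideal_prod R I (ideal_pow R I k)"

definition is_reduction :: "('a, 'b) ring_scheme \<Rightarrow> 'a set \<Rightarrow> 'a set \<Rightarrow> bool" where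
  "is_reduction R J I \<longleftrightarrow> ideal J R \<and> J \<subseteq> I \<and>
     (\<exists>m::nat. m > 0 \<and> ideal_pow R I (Suc m) = ideal_prod R J (ideal_pow R I m))"

definition has_proper_reduction :: "('a, 'b) ring_scheme \<Rightarrow> 'a set \<Rightarrow> bool" where
  "has_proper_reduction R I \<longleftrightarrow> (\<exists>J. is_reduction R J I \<and> J \<noteq> I)"

definition minimally_generated_by :: "('a, 'b) ring_scheme \<Rightarrow> 'a set \<Rightarrow> nat \<Rightarrow> bool" where
  "minimally_generated_by R I n \<longleftrightarrow>
     (\<exists>S. S \<subseteq> carrier R \<and> finite S \<and> card S = n \<and> Idl\<^bsub>R\<^esub> S = I) \<and>
     (\<forall>S. S \<subseteq> carrier R \<and> finite S \<and> Idl\<^bsub>R\<^esub> S = I \<longrightarrow> n \<le> card S)"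

definition has_prime_chain :: "('a, 'b) ring_scheme \<Rightarrow> nat \<Rightarrow> bool" where
  "has_prime_chain R n \<longleftrightarrow> (\<exists>P :: nat \<Rightarrow> 'a set.
     (\<forall>i\<le>n. primeideal (P i) R) \<and> (\<forall>i<n. P i \<subset> P (Suc i)))"

definition krull_dim :: "('a, 'b) ring_scheme \<Rightarrow> enat" where
  "krull_dim R = (SUP n \<in> {n. has_prime_chain R n}. enat n)"

definition local_ring_with :: "('a, 'b) ring_scheme \<Rightarrow> 'a set \<Rightarrow> bool" where
  "local_ring_with R m \<longleftrightarrow> cring R \<and> maximalideal m R \<and> (\<forall>M. maximalideal M R \<longrightarrow> M = m)"

definition radical_ideal :: "('a, 'b) ring_scheme \<Rightarrow> 'a set \<Rightarrow> 'a set" where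
  "radical_ideal R I = {a \<in> carrier R. \<exists>k::nat. a [^]\<^bsub>R\<^esub> k \<in> I}"

definition primary_ideal :: "('a, 'b) ring_scheme \<Rightarrow> 'a set \<Rightarrow> bool" where
  "primary_ideal R Q \<longleftrightarrow> ideal Q R \<and> Q \<noteq> carrier R \<and>
     (\<forall>a\<in>carrier R. \<forall>b\<in>carrier R. a \<otimes>\<^bsub>R\<^esub> b \<in> Q \<longrightarrow> a \<in> Q \<or> (\<exists>k::nat. b [^]\<^bsub>R\<^esub> k \<in> Q))"

definition primary_to :: "('a, 'b) ring_scheme \<Rightarrow> 'a set \<Rightarrow> 'a set \<Rightarrow> bool" where
  "primary_to R m Q \<longleftrightarrow> primary_ideal R Q \<and> radical_ideal R Q = m"

end

theory Submission
  imports Defs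
begin

text \<open>
  Let \<open>P c\<close> be pairwise incomparable primes, indexed by the nonzero vectors \<open>c\<close> of length \<open>n\<close> over
  the finite field \<open>R / m\<close>, and let \<open>a 0, \<dots>, a (n - 1)\<close> satisfy \<open>a i \<equiv> c i * u c\<close> modulo \<open>P c\<close> with
  \<open>u c \<notin> P c\<close>. A proper reduction \<open>J\<close> of \<open>I = (a 0, \<dots>, a (n - 1))\<close> lies in a hyperplane
  of \<open>I / m I\<close>, whose normal vector \<open>c\<close> is one of the indices. In the domain \<open>R / P c\<close> the image of \<open>I\<close> is
  generated by \<open>u c\<close> while \<open>J\<close> maps into \<open>m * u c\<close>, so \<open>I ^ (t + 1) = J * I ^ t\<close> is
  impossible there. The same congruences force \<open>n\<close> generators.

  The primes are taken directly below \<open>m\<close>; by Krull's principal ideal theorem and prime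
  avoidance there are infinitely many of them when \<open>dim R \<ge> 2\<close>. Each \<open>a i\<close> may still be
  altered by elements of the intersection of all \<open>P c\<close>, and prime avoidance in this coset makes the
  primes over \<open>a 0, \<dots>, a (i - 1)\<close> other than \<open>m\<close> and the \<open>P c\<close> have height at least \<open>i\<close>. If
  \<open>n \<ge> dim R\<close>, only \<open>m\<close> can then contain \<open>I\<close>.
\<close>

section \<open>Ideals of commutative rings\<close>

context cring
begin

lemma ideal_closedI:
  assumes "S \<subseteq> carrier R" "\<zero> \<in> S" "\<And>x y. x \<in> S \<Longrightarrow> y \<in> S \<Longrightarrow> x \<oplus> y \<in> S"
    and mult: "\<And>r x. r \<in> carrier R \<Longrightarrow> x \<in> S \<Longrightarrow> r \<otimes> x \<in> S"
  shows "ideal S R"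
proof (rule idealI)
  have "\<ominus> x \<in> S" if "x \<in> S" for x
    using mult[of "\<ominus> \<one>" x] that assms(1) by (simp add: l_minus subsetD)
  then show "subgroup S (add_monoid R)"
    using assms by (auto simp: subgroup_def simp flip: a_inv_def)
  show "x \<otimes> a \<in> S" "a \<otimes> x \<in> S" if "a \<in> S" "x \<in> carrier R" for a x
    using mult[OF that(2,1)] that assms(1) by (auto simp: m_comm subsetD)
qed (rule ring_axioms)

lemma ideal_carr: "ideal I R \<Longrightarrow> x \<in> I \<Longrightarrow> x \<in> carrier R"
  by (rule ideal.Icarr)

lemma ideal_zero: "ideal I R \<Longrightarrow> \<zero> \<in> I"
  by (simp add: additive_subgroup.zero_closed ideal.axioms(1))

lemma ideal_add: "ideal I R \<Longrightarrow> x \<in> I \<Longrightarrow> y \<in> I \<Longrightarrow> x \<oplus> y \<in> I"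
  by (simp add: additive_subgroup.a_closed ideal.axioms(1))

lemma ideal_mult: "ideal I R \<Longrightarrow> r \<in> carrier R \<Longrightarrow> x \<in> I \<Longrightarrow> r \<otimes> x \<in> I"
  by (rule ideal.I_l_closed)

lemma ideal_diff: "ideal I R \<Longrightarrow> x \<in> I \<Longrightarrow> y \<in> I \<Longrightarrow> x \<ominus> y \<in> I"
  by (simp add: a_minus_def ideal_add additive_subgroup.a_inv_closed ideal.axioms(1))

section \<open>Congruences modulo an ideal, written as membership of differences\<close>

lemma ideal_cong_mem_iff:
  assumes "ideal I R" "x \<ominus> y \<in> I" "x \<in> carrier R" "y \<in> carrier R"
  shows "x \<in> I \<longleftrightarrow> y \<in> I"
proof -
  have "x = (x \<ominus> y) \<oplus> y" "y = x \<ominus> (x \<ominus> y)" using assms(3,4) by algebra+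
  then show ?thesis using assms ideal_add ideal_diff by metis
qed

lemma ideal_cong_trans:
  assumes "ideal I R" "x \<ominus> y \<in> I" "y \<ominus> z \<in> I" 
    and c: "x \<in> carrier R" "y \<in> carrier R" "z \<in> carrier R"
  shows "x \<ominus> z \<in> I"
proof -
  have "x \<ominus> z = (x \<ominus> y) \<oplus> (y \<ominus> z)" using c by algebra
  then show ?thesis using assms by (simp add: ideal_add)
qed

lemma ideal_cong_sym:
  assumes "ideal I R" "x \<ominus> y \<in> I" "x \<in> carrier R" "y \<in> carrier R"
  shows "y \<ominus> x \<in> I"
proof -
  have "y \<ominus> x = \<zero> \<ominus> (x \<ominus> y)" using assms(3,4) by algebra
  then show ?thesis using assms by (simp add: ideal_diff ideal_zero)
qed

lemma ideal_cong_mult: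
  assumes "ideal I R" "x \<ominus> y \<in> I" "z \<ominus> w \<in> I"
    and c: "x \<in> carrier R" "y \<in> carrier R" "z \<in> carrier R" "w \<in> carrier R"
  shows "x \<otimes> z \<ominus> y \<otimes> w \<in> I"
proof -
  have "x \<otimes> z \<ominus> y \<otimes> w = z \<otimes> (x \<ominus> y) \<oplus> y \<otimes> (z \<ominus> w)" using c by algebra
  then show ?thesis using assms by (simp add: ideal_add ideal_mult)
qed

lemma ideal_cong_add:
  assumes "ideal I R" "x \<ominus> y \<in> I" "z \<ominus> w \<in> I"
    and c: "x \<in> carrier R" "y \<in> carrier R" "z \<in> carrier R" "w \<in> carrier R"
  shows "(x \<oplus> z) \<ominus> (y \<oplus> w) \<in> I"
proof -
  have "(x \<oplus> z) \<ominus> (y \<oplus> w) = (x \<ominus> y) \<oplus> (z \<ominus> w)" using c by algebra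
  then show ?thesis using assms by (simp add: ideal_add)
qed

lemma ideal_cong_power:
  assumes "ideal I R" "x \<ominus> y \<in> I" "x \<in> carrier R" "y \<in> carrier R"
  shows "x [^] (k::nat) \<ominus> y [^] k \<in> I"
proof (induction k)
  case 0
  then show ?case using assms(1) by (simp add: ideal_zero a_minus_def r_neg)
next
  case (Suc k)
  then show ?case using assms by (simp add: ideal_cong_mult)
qed

lemma prime_ideal: "primeideal P R \<Longrightarrow> ideal P R"
  by (rule primeideal.axioms(1))

lemma prime_dest:
  "primeideal P R \<Longrightarrow> a \<in> carrier R \<Longrightarrow> b \<in> carrier R \<Longrightarrow> a \<otimes> b \<in> P \<Longrightarrow> a \<in> P \<or> b \<in> P"
  by (rule primeideal.I_prime)

lemma one_notin_prime: "primeideal P R \<Longrightarrow> \<one> \<notin> P"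
  using ideal.one_imp_carrier primeideal.I_notcarr prime_ideal by metis

lemma prime_power_dest:
  assumes "primeideal P R" "a \<in> carrier R" "a [^] (k::nat) \<in> P"
  shows "a \<in> P"
  using assms(3)
proof (induction k)
  case 0
  then show ?case using one_notin_prime[OF assms(1)] by simp
next
  case (Suc k)
  then show ?case using prime_dest[OF assms(1), of "a [^] k" a] assms(2) by auto
qed

section \<open>Enlarging an ideal by one element\<close>

lemma add_principal_iff:
  "z \<in> I <+>\<^bsub>R\<^esub> PIdl a \<longleftrightarrow> (\<exists>i\<in>I. \<exists>r\<in>carrier R. z = i \<oplus> r \<otimes> a)"
  by (auto simp: set_add_def' cgenideal_def)

lemma add_principal_ideal:
  "ideal I R \<Longrightarrow> a \<in> carrier R \<Longrightarrow> ideal (I <+>\<^bsub>R\<^esub> PIdl a) R"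
  by (simp add: add_ideals cgenideal_ideal)

lemma add_principal_psubset:
  assumes "ideal I R" "a \<in> carrier R" "a \<notin> I"
  shows "I \<subset> I <+>\<^bsub>R\<^esub> PIdl a"
proof -
  have "x = x \<oplus> \<zero> \<otimes> a" if "x \<in> I" for x
    using assms(1,2) that ideal_carr by fastforce
  then have "I \<subseteq> I <+>\<^bsub>R\<^esub> PIdl a"
    unfolding subset_iff add_principal_iff by blast
  moreover have "a \<in> I <+>\<^bsub>R\<^esub> PIdl a"
    unfolding add_principal_iff using assms(1,2) ideal_zero
    by (intro bexI[of _ \<zero>] bexI[of _ \<one>]) auto
  ultimately show ?thesis using assms(3) by blast
qed

lemma add_principal_subset:
  assumes "ideal M R" "I \<subseteq> M" "a \<in> M"
  shows "I <+>\<^bsub>R\<^esub> PIdl a \<subseteq> M"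
  unfolding subset_iff add_principal_iff
  using assms by (auto intro!: ideal_add ideal_mult)

section \<open>Prime avoidance\<close>

text \<open>Pick an element outside \<open>P\<close> in each ideal; the product lies in all the
  ideals and, \<open>P\<close> being prime, not in \<open>P\<close>.\<close>

lemma prime_avoids_ideals:
  assumes "finite A" "\<And>I. I \<in> A \<Longrightarrow> ideal I R" "primeideal P R" "\<And>I. I \<in> A \<Longrightarrow> \<not> I \<subseteq> P"
  obtains z where "z \<in> carrier R" "\<And>I. I \<in> A \<Longrightarrow> z \<in> I" "z \<notin> P"
proof -
  have "\<exists>z\<in>carrier R. (\<forall>I\<in>A. z \<in> I) \<and> z \<notin> P"
    using assms(1,2,4)
  proof (induction A rule: finite_induct)
    case empty
    then show ?case using one_notin_prime[OF assms(3)] by auto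
  next
    case (insert I A)
    then obtain z where z: "z \<in> carrier R" "\<forall>I\<in>A. z \<in> I" "z \<notin> P" by auto
    obtain y where y: "y \<in> I" "y \<notin> P" using insert.prems by blast
    have yc: "y \<in> carrier R" using y insert.prems ideal_carr by blast
    have "y \<otimes> z \<notin> P" using prime_dest[OF assms(3) yc z(1)] y z by blast
    moreover have "y \<otimes> z \<in> I'" if "I' \<in> insert I A" for I'
    proof (cases "I' = I")
      case True
      then show ?thesis using y(1) z(1) yc insert.prems(1)[of I] ideal_mult[of I z y] m_comm by auto
    next
      case False
      then show ?thesis using z(2) yc insert.prems(1)[OF that] ideal_mult that by blast
    qed
    ultimately show ?case using z(1) yc by blast
  qed
  then show thesis using that by blast
qed

text \<open>If a coset element avoids all primes but \<open>Q\<close>, it is corrected by some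
  \<open>z\<close> that lies in \<open>K\<close> and in the other primes but not in
  \<open>Q\<close>. The coset form allows generators to be altered later without disturbing their
  congruences.\<close>

lemma coset_prime_avoidance:
  assumes "finite A" "\<And>Q. Q \<in> A \<Longrightarrow> primeideal Q R" "ideal K R" "\<And>Q. Q \<in> A \<Longrightarrow> \<not> K \<subseteq> Q"
    and a: "a \<in> carrier R"
  shows "\<exists>w\<in>K. \<forall>Q\<in>A. a \<oplus> w \<notin> Q"
  using assms(1,2,4)
proof (induction A rule: finite_psubset_induct)
  case (psubset A)
  show ?case
  proof (cases "A = {}")
    case True
    then show ?thesis using ideal_zero[OF assms(3)] by blast
  next
    case False
    \<comment> \<open>Minimality keeps every other prime of \<open>A\<close> from lying inside
      \<open>Q\<close>, which is what makes \<open>z\<close> exist below.\<close>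
    then obtain Q where Q: "Q \<in> A" "\<And>Q'. Q' \<in> A \<Longrightarrow> Q' \<subseteq> Q \<Longrightarrow> Q' = Q"
      using finite_has_minimal[OF psubset.hyps(1)] by metis
    obtain w where w: "w \<in> K" "\<forall>Q'\<in>A - {Q}. a \<oplus> w \<notin> Q'"
      using psubset.IH[of "A - {Q}"] Q(1) psubset.prems by blast
    have wc: "w \<in> carrier R" using w(1) assms(3) ideal_carr by blast
    have QP: "primeideal Q R" using psubset.prems(1) Q(1) by blast
    show ?thesis
    proof (cases "a \<oplus> w \<in> Q")
      case False
      then show ?thesis using w by blast
    next
      case True
      obtain z where z: "z \<in> carrier R" "\<And>I. I \<in> insert K (A - {Q}) \<Longrightarrow> z \<in> I" "z \<notin> Q"
        using prime_avoids_ideals[of "insert K (A - {Q})" Q] psubset.prems QP Q psubset.hyps(1)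
          assms(3) prime_ideal by (metis Diff_iff finite_Diff finite_insert insertE insertI1)
      have e: "(a \<oplus> (w \<oplus> z)) \<ominus> z = a \<oplus> w" "(a \<oplus> (w \<oplus> z)) \<ominus> (a \<oplus> w) = z" 
        using a wc z(1) by algebra+
      have "a \<oplus> (w \<oplus> z) \<notin> Q'" if "Q' \<in> A" for Q'
      proof (cases "Q' = Q")
        case True
        then show ?thesis using e(2) \<open>a \<oplus> w \<in> Q\<close> z(3) QP ideal_diff prime_ideal by metis
      next
        case False
        then have "z \<in> Q'" "a \<oplus> w \<notin> Q'" "ideal Q' R"
          using that z w psubset.prems prime_ideal by auto
        then show ?thesis using e(1) ideal_diff by metis
      qed
      then show ?thesis using w(1) z(2) ideal_add[OF assms(3)] by blast
    qed
  qed
qed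

end

section \<open>Noetherian rings\<close>

context noetherian_ring
begin

text \<open>Ascending chains become stationary, so the union of a nonempty chain of ideals belongs
  to the chain and Zorn's lemma applies.\<close>

lemma ideal_family_maximal:
  assumes "S \<noteq> {}" "\<And>I. I \<in> S \<Longrightarrow> ideal I R"
  shows "\<exists>M\<in>S. \<forall>I\<in>S. M \<subseteq> I \<longrightarrow> I = M"
proof (rule subset_Zorn_nonempty[OF assms(1)])
  fix C assume C: "C \<noteq> {}" "subset.chain S C"
  then have "subset.chain {I. ideal I R} C" using assms(2) by (auto simp: subset.chain_def)
  then have "\<Union> C \<in> C" using ideal_chain_is_trivial C by blast
  then show "\<Union> C \<in> S" using C by (auto simp: subset.chain_def)
qed

lemma noetherian_induct [consumes 1, case_names step]:
  assumes "ideal I R" "\<And>I. ideal I R \<Longrightarrow> (\<And>J. ideal J R \<Longrightarrow> I \<subset> J \<Longrightarrow> Q J) \<Longrightarrow> Q I"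
  shows "Q I"
proof (rule ccontr)
  assume "\<not> Q I"
  then obtain M where "M \<in> {J. ideal J R \<and> \<not> Q J}"
      "\<And>J. J \<in> {J. ideal J R \<and> \<not> Q J} \<Longrightarrow> M \<subseteq> J \<Longrightarrow> J = M"
    using ideal_family_maximal[of "{J. ideal J R \<and> \<not> Q J}"] assms(1) by blast
  then show False using assms(2)[of M] by blast
qed

end

locale noetherian_cring = noetherian_ring R + cring R for R (structure)
begin

text \<open>Noetherian induction: an ideal that is neither prime nor \<open>carrier R\<close> misses
  two elements whose product it contains, and these produce larger ideals. The rule serves where
  primary decomposition or prime filtrations are customary.\<close>

lemma prime_induct [consumes 1, case_names carrier prime split]:
  assumes "ideal I R"
    and "Q (carrier R)"
    and "\<And>P. primeideal P R \<Longrightarrow> Q P"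
    and "\<And>I a b. \<lbrakk>ideal I R; a \<in> carrier R; b \<in> carrier R; a \<notin> I; b \<notin> I; a \<otimes> b \<in> I;
           \<And>J. ideal J R \<Longrightarrow> I \<subset> J \<Longrightarrow> Q J\<rbrakk> \<Longrightarrow> Q I"
  shows "Q I"
  using assms(1)
proof (induction rule: noetherian_induct)
  case (step I)
  show ?case
  proof (cases "primeideal I R \<or> I = carrier R")
    case True
    then show ?thesis using assms(2,3) by blast
  next
    case False
    then obtain a b where "a \<in> carrier R" "b \<in> carrier R" "a \<otimes> b \<in> I" "a \<notin> I" "b \<notin> I"
      using primeidealI[OF step.hyps is_cring] by blast
    then show ?thesis using assms(4) step by blast
  qed
qed

text \<open>A prime over \<open>I\<close> that contains \<open>a * b\<close> contains
  \<open>a\<close> or \<open>b\<close>, so covers of \<open>I + (a)\<close> and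
  \<open>I + (b)\<close> together cover \<open>I\<close>. The resulting set includes all minimal
  primes over \<open>I\<close>, possibly with others.\<close>

lemma finite_prime_cover:
  assumes "ideal I R"
  shows "\<exists>A. finite A \<and> (\<forall>Q\<in>A. primeideal Q R \<and> I \<subseteq> Q)
    \<and> (\<forall>P. primeideal P R \<longrightarrow> I \<subseteq> P \<longrightarrow> (\<exists>Q\<in>A. Q \<subseteq> P))"
  using assms
proof (induction rule: prime_induct)
  case carrier
  have "\<not> carrier R \<subseteq> P" if "primeideal P R" for P
    using one_notin_prime[OF that] by blast
  then show ?case by (intro exI[of _ "{}"]) auto
next
  case (prime P)
  then show ?case by (intro exI[of _ "{P}"]) auto
next
  case (split I a b)
  let ?I = "I <+>\<^bsub>R\<^esub> PIdl a" and ?J = "I <+>\<^bsub>R\<^esub> PIdl b"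
  have ext: "ideal ?I R" "ideal ?J R" "I \<subset> ?I" "I \<subset> ?J"
    using split add_principal_ideal add_principal_psubset by auto
  obtain A where A: "finite A" "\<forall>Q\<in>A. primeideal Q R \<and> ?I \<subseteq> Q"
    "\<And>P. primeideal P R \<Longrightarrow> ?I \<subseteq> P \<Longrightarrow> \<exists>Q\<in>A. Q \<subseteq> P"
    using split.IH[OF ext(1,3)] by blast
  obtain B where B: "finite B" "\<forall>Q\<in>B. primeideal Q R \<and> ?J \<subseteq> Q"
    "\<And>P. primeideal P R \<Longrightarrow> ?J \<subseteq> P \<Longrightarrow> \<exists>Q\<in>B. Q \<subseteq> P"
    using split.IH[OF ext(2,4)] by blast
  have "\<exists>Q\<in>A \<union> B. Q \<subseteq> P" if P: "primeideal P R" "I \<subseteq> P" for P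
  proof -
    have "a \<in> P \<or> b \<in> P" using prime_dest P split by blast
    then have "?I \<subseteq> P \<or> ?J \<subseteq> P" using add_principal_subset P prime_ideal by blast
    then show ?thesis using A(3)[OF P(1)] B(3)[OF P(1)] by blast
  qed
  then show ?case using A(1,2) B(1,2) ext(3,4) by (intro exI[of _ "A \<union> B"]) blast
qed

text \<open>If powers of \<open>x\<close> lie in \<open>I + (a)\<close> and in
  \<open>I + (b)\<close>, their product lies in \<open>I\<close>: each term of its expansion has a
  factor in \<open>I\<close> or the factor \<open>a * b\<close>.\<close>

lemma power_mem_of_primes:
  assumes "ideal I R" "x \<in> carrier R" "\<And>P. primeideal P R \<Longrightarrow> I \<subseteq> P \<Longrightarrow> x \<in> P"
  shows "\<exists>k::nat. x [^] k \<in> I"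
  using assms(1,3)
proof (induction rule: prime_induct)
  case carrier
  then show ?case using assms(2) by auto
next
  case (prime P)
  then have "x [^] (1::nat) \<in> P" using assms(2) by simp
  then show ?case by blast
next
  case (split I a b)
  let ?I = "I <+>\<^bsub>R\<^esub> PIdl a" and ?J = "I <+>\<^bsub>R\<^esub> PIdl b"
  have ext: "ideal ?I R" "ideal ?J R" "I \<subset> ?I" "I \<subset> ?J"
    using split add_principal_ideal add_principal_psubset by auto
  obtain k l :: nat where "x [^] k \<in> ?I" "x [^] l \<in> ?J"
    using split.IH[OF ext(1,3)] split.IH[OF ext(2,4)] split.prems ext(3,4)
    by (meson order_trans psubset_imp_subset)
  then obtain i r j s where *: "i \<in> I" "r \<in> carrier R" "x [^] k = i \<oplus> r \<otimes> a"
      "j \<in> I" "s \<in> carrier R" "x [^] l = j \<oplus> s \<otimes> b"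
    unfolding add_principal_iff by blast
  have c: "i \<in> carrier R" "j \<in> carrier R" using * split ideal_carr by auto
  have "x [^] (k + l) = (i \<oplus> r \<otimes> a) \<otimes> (j \<oplus> s \<otimes> b)"
    using * assms(2) by (simp flip: nat_pow_mult)
  also have "\<dots> = (j \<oplus> s \<otimes> b) \<otimes> i \<oplus> ((r \<otimes> a) \<otimes> j \<oplus> (r \<otimes> s) \<otimes> (a \<otimes> b))"
    using * c split.hyps(2,3) by algebra
  also have "\<dots> \<in> I"
    using * c split.hyps by (simp add: ideal_add ideal_mult)
  finally show ?case by blast
qed

end

section \<open>Noetherian local rings\<close>

locale noetherian_local_ring = noetherian_cring R for R (structure) +
  fixes m
  assumes maximal: "maximalideal m R"
    and maximal_unique: "maximalideal M R \<Longrightarrow> M = m"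
begin

lemma m_prime: "primeideal m R"
  using maximalideal_prime[OF maximal] .

lemma m_ideal: "ideal m R"
  using prime_ideal[OF m_prime] .

text \<open>An ideal maximal among the proper ideals over \<open>I\<close> is a maximal ideal, hence
  equal to \<open>m\<close>.\<close>

lemma proper_subset_m:
  assumes "ideal I R" "\<one> \<notin> I"
  shows "I \<subseteq> m"
proof -
  let ?S = "{J. ideal J R \<and> I \<subseteq> J \<and> \<one> \<notin> J}"
  have "\<exists>M\<in>?S. \<forall>J\<in>?S. M \<subseteq> J \<longrightarrow> J = M"
    by (rule ideal_family_maximal) (use assms in blast)+
  then obtain M where max: "M \<in> ?S" "\<forall>J\<in>?S. M \<subseteq> J \<longrightarrow> J = M" by (rule bexE)
  note M = max(1) max(2)[rule_format]
  have "maximalideal M R"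
  proof (rule maximalidealI)
    show "ideal M R" "carrier R \<noteq> M" using M(1) by auto
    fix J assume J: "ideal J R" "M \<subseteq> J" "J \<subseteq> carrier R"
    show "J = M \<or> J = carrier R"
      using M J ideal.one_imp_carrier[OF J(1)] by (cases "\<one> \<in> J") auto
  qed
  then show ?thesis using maximal_unique M(1) by blast
qed

lemma prime_subset_m: "primeideal P R \<Longrightarrow> P \<subseteq> m"
  using proper_subset_m prime_ideal one_notin_prime by blast

lemma inverse_outside_m:
  assumes "r \<in> carrier R" "r \<notin> m"
  obtains s where "s \<in> carrier R" "s \<otimes> r = \<one>"
proof -
  have "\<one> \<in> PIdl r"
    using proper_subset_m[OF cgenideal_ideal[OF assms(1)]] cgenideal_self[OF assms(1)] assms(2) by blast
  then show thesis using that by (auto simp: cgenideal_def)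
qed

lemma mem_of_mult_outside_m:
  assumes "ideal I R" "r \<in> carrier R" "r \<notin> m" "y \<in> carrier R" "r \<otimes> y \<in> I"
  shows "y \<in> I"
proof -
  obtain s where s: "s \<in> carrier R" "s \<otimes> r = \<one>" using inverse_outside_m assms by blast
  have "y = s \<otimes> (r \<otimes> y)" using s assms by (simp flip: m_assoc)
  then show ?thesis using ideal_mult[OF assms(1) s(1) assms(5)] by simp
qed

lemma one_minus_notin_m:
  assumes "x \<in> m"
  shows "\<one> \<ominus> x \<notin> m"
  using ideal_cong_mem_iff[OF m_ideal, of \<one> x] assms one_notin_prime[OF m_prime] ideal_carr[OF m_ideal]
  by auto

text \<open>Nakayama's lemma: the quotient of \<open>I\<close> by \<open>H\<close> is a simple module, so \<open>m\<close> kills it.\<close>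

lemma maximal_proper_subideal:
  assumes "ideal I R" "ideal J R" "J \<subset> I"
  obtains H where "ideal H R" "J \<subseteq> H" "H \<subset> I"
    "\<And>x y. x \<in> m \<Longrightarrow> y \<in> I \<Longrightarrow> x \<otimes> y \<in> H"
    "\<And>y z. y \<in> I \<Longrightarrow> y \<notin> H \<Longrightarrow> z \<in> I \<Longrightarrow> \<exists>r\<in>carrier R. z \<ominus> r \<otimes> y \<in> H"
proof -
  let ?S = "{H. ideal H R \<and> J \<subseteq> H \<and> H \<subset> I}"
  have "\<exists>H\<in>?S. \<forall>K\<in>?S. H \<subseteq> K \<longrightarrow> K = H"
    by (rule ideal_family_maximal) (use assms in blast)+
  then obtain H where max: "H \<in> ?S" "\<forall>K\<in>?S. H \<subseteq> K \<longrightarrow> K = H" by (rule bexE)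
  note H = max(1) max(2)[rule_format]
  have gen: "\<exists>r\<in>carrier R. z \<ominus> r \<otimes> y \<in> H" if "y \<in> I" "y \<notin> H" "z \<in> I" for y z
  proof -
    have c: "y \<in> carrier R" "z \<in> carrier R" using that assms(1) ideal_carr by auto
    have "H \<subset> H <+>\<^bsub>R\<^esub> PIdl y" "ideal (H <+>\<^bsub>R\<^esub> PIdl y) R" "H <+>\<^bsub>R\<^esub> PIdl y \<subseteq> I"
      using add_principal_psubset[of H y] add_principal_ideal[of H y] add_principal_subset[of I H y]
        H(1) that c assms(1) by auto
    then have "H <+>\<^bsub>R\<^esub> PIdl y = I" using H(1) H(2)[of "H <+>\<^bsub>R\<^esub> PIdl y"] by blast
    then obtain h r where hr: "h \<in> H" "r \<in> carrier R" "z = h \<oplus> r \<otimes> y"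
      using \<open>z \<in> I\<close> by (metis add_principal_iff)
    have "h \<in> carrier R" using hr H(1) ideal_carr by blast
    then have "z \<ominus> r \<otimes> y = h" unfolding hr(3) using hr(2) c by algebra
    then show ?thesis using hr by blast
  qed
  have "x \<otimes> y \<in> H" if xy: "x \<in> m" "y \<in> I" for x y
  proof (rule ccontr)
    assume n: "x \<otimes> y \<notin> H"
    have c: "x \<in> carrier R" "y \<in> carrier R" using xy assms(1) m_ideal ideal_carr by auto
    obtain r where r: "r \<in> carrier R" "y \<ominus> r \<otimes> (x \<otimes> y) \<in> H"
      using gen[OF _ n xy(2)] ideal_mult[OF assms(1) c(1) xy(2)] by blast
    have "y \<ominus> r \<otimes> (x \<otimes> y) = (\<one> \<ominus> r \<otimes> x) \<otimes> y" using c r(1) by algebra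
    then have "y \<in> H"
      using mem_of_mult_outside_m[of H "\<one> \<ominus> r \<otimes> x" y] one_minus_notin_m[of "r \<otimes> x"] 
        ideal_mult[OF m_ideal r(1) xy(1)] H(1) r c by auto
    then show False using n H(1) ideal_mult c by blast
  qed
  then show thesis using that H(1) gen by blast
qed

end

locale finite_residue_local_ring = noetherian_local_ring R m for R (structure) and m +
  assumes finite_residue: "finite (carrier (R Quot m))"
begin

section \<open>Representatives of the residue field\<close>

text \<open>The choice depends on the coset only, so congruent elements share a representative. The
  finite image of \<open>rep\<close> serves as a copy of the residue field inside
  \<open>R\<close>.\<close>

definition rep :: "'a \<Rightarrow> 'a" where
  "rep x = (SOME y. y \<in> m +>\<^bsub>R\<^esub> x)"

lemma rep_coset:
  assumes "x \<in> carrier R"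
  shows "rep x \<in> m +>\<^bsub>R\<^esub> x"
  unfolding rep_def
  using abelian_subgroup.a_rcos_self[OF abelian_subgroupI3[OF ideal.axioms(1)[OF m_ideal] is_abelian_group] assms]
  by (rule someI)

lemma rep_closed: "x \<in> carrier R \<Longrightarrow> rep x \<in> carrier R"
  using rep_coset a_r_coset_subset_G[OF subsetI[OF ideal_carr[OF m_ideal]]] by blast

lemma rep_cong:
  assumes "x \<in> carrier R"
  shows "x \<ominus> rep x \<in> m"
proof -
  have "m +>\<^bsub>R\<^esub> rep x = m +>\<^bsub>R\<^esub> x"
    using rep_coset[OF assms] assms abelian_subgroup.a_repr_independence'
      abelian_subgroupI3[OF ideal.axioms(1)[OF m_ideal] is_abelian_group] by metis
  then show ?thesis using quotient_eq_iff_same_a_r_cos[OF m_ideal assms rep_closed[OF assms]] by simp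
qed

lemma rep_eq:
  assumes "x \<in> carrier R" "y \<in> carrier R" "x \<ominus> y \<in> m"
  shows "rep x = rep y"
  using quotient_eq_iff_same_a_r_cos[OF m_ideal assms(1,2)] assms(3) by (simp add: rep_def)

lemma rep_eq_iff:
  assumes "x \<in> carrier R" "y \<in> carrier R"
  shows "rep x = rep y \<longleftrightarrow> x \<ominus> y \<in> m"
  using rep_eq[OF assms] rep_cong assms rep_closed ideal_cong_trans[OF m_ideal] ideal_cong_sym[OF m_ideal]
  by metis

lemma rep_rep: "x \<in> carrier R \<Longrightarrow> rep (rep x) = rep x"
  using rep_eq rep_cong rep_closed by metis

lemma finite_reps: "finite (rep ` carrier R)"
proof -
  have "rep ` carrier R = (\<lambda>C. SOME y. y \<in> C) ` carrier (R Quot m)"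
    by (auto simp: FactRing_def A_RCOSETS_def' rep_def image_iff)
  then show ?thesis using finite_residue by simp
qed

section \<open>Finite quotients and Krull's principal ideal theorem\<close>

text \<open>In the split case \<open>R / I\<close> is an extension of \<open>R / (I + (a))\<close>
  by a copy of \<open>R / (I : a)\<close>; the element \<open>b\<close> shows that the colon ideal
  \<open>?J\<close> is larger than \<open>I\<close>. The prime case is the finite residue
  field.\<close>

lemma finite_quotient:
  assumes "ideal I R" "\<And>P. primeideal P R \<Longrightarrow> I \<subseteq> P \<Longrightarrow> P = m"
  shows "\<exists>T. finite T \<and> T \<subseteq> carrier R \<and> (\<forall>r\<in>carrier R. \<exists>t\<in>T. r \<ominus> t \<in> I)"
  using assms
proof (induction rule: prime_induct)
  case carrier
  then show ?case by (intro exI[of _ "{\<zero>}"]) auto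
next
  case (prime P)
  then have "P = m" by blast
  then show ?case using finite_reps rep_cong rep_closed
    by (intro exI[of _ "rep ` carrier R"]) auto
next
  case (split I a b)
  let ?I = "I <+>\<^bsub>R\<^esub> PIdl a" and ?J = "{r \<in> carrier R. a \<otimes> r \<in> I}"
  have I: "ideal ?I R" "I \<subset> ?I"
    using split add_principal_ideal add_principal_psubset by auto
  have J: "ideal ?J R"
  proof (rule ideal_closedI)
    show "r \<otimes> x \<in> ?J" if "r \<in> carrier R" "x \<in> ?J" for r x
    proof -
      have "a \<otimes> (r \<otimes> x) = r \<otimes> (a \<otimes> x)" using that split.hyps(2) by (simp add: m_lcomm)
      then show ?thesis using that split.hyps ideal_mult by auto
    qed
  qed (use split.hyps in \<open>auto simp: ideal_zero ideal_add r_distr\<close>)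
  have IJ: "I \<subset> ?J" using split.hyps ideal_mult ideal_carr by blast
  obtain T where T: "finite T" "T \<subseteq> carrier R" "\<forall>r\<in>carrier R. \<exists>t\<in>T. r \<ominus> t \<in> ?I"
    using split.IH[OF I] split.prems I(2) by (meson order_trans psubset_imp_subset)
  obtain U where U: "finite U" "U \<subseteq> carrier R" "\<forall>r\<in>carrier R. \<exists>t\<in>U. r \<ominus> t \<in> ?J"
    using split.IH[OF J IJ] split.prems IJ by (meson order_trans psubset_imp_subset)
  \<comment> \<open>Modulo \<open>I\<close> an element is \<open>t + s * a\<close>, and
    \<open>s\<close> matters only modulo \<open>?J\<close>.\<close>
  let ?V = "(\<lambda>(t,u). t \<oplus> a \<otimes> u) ` (T \<times> U)"
  have "\<exists>v\<in>?V. r \<ominus> v \<in> I" if r: "r \<in> carrier R" for r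
  proof -
    obtain t where t: "t \<in> T" "r \<ominus> t \<in> ?I" using T(3) r by blast
    then obtain i s where is': "i \<in> I" "s \<in> carrier R" "r \<ominus> t = i \<oplus> s \<otimes> a"
      unfolding add_principal_iff by blast
    obtain u where u: "u \<in> U" "s \<ominus> u \<in> ?J" using U(3) is' by blast
    have c: "i \<in> carrier R" "t \<in> carrier R" "u \<in> carrier R"
      using is' split.hyps(1) ideal_carr t u T U by auto
    have "r \<ominus> (t \<oplus> a \<otimes> u) = (r \<ominus> t) \<ominus> a \<otimes> u" using c r split.hyps(2) by algebra
    also have "\<dots> = i \<oplus> a \<otimes> (s \<ominus> u)" unfolding is'(3) using c is'(2) split.hyps(2) by algebra
    also have "\<dots> \<in> I" using is' u split.hyps(1) by (simp add: ideal_add)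
    finally show ?thesis using t u by (intro bexI[of _ "t \<oplus> a \<otimes> u"]) auto
  qed
  moreover have "finite ?V" "?V \<subseteq> carrier R" using T(1,2) U(1,2) split.hyps(2) by (auto simp: subset_iff)
  ultimately show ?case by blast
qed

text \<open>Membership is constant on cosets of \<open>I\<close>, so an ideal above \<open>I\<close>
  is determined by its trace on \<open>T\<close>. In the principal ideal theorem this finiteness
  stands in for the descending chain condition.\<close>

lemma finite_ideals_above:
  assumes "ideal I R" "finite T" "T \<subseteq> carrier R" "\<And>r. r \<in> carrier R \<Longrightarrow> \<exists>t\<in>T. r \<ominus> t \<in> I"
  shows "finite {J. ideal J R \<and> I \<subseteq> J}"
proof -
  have "J \<subseteq> K" if "ideal J R" "I \<subseteq> J" "ideal K R" "I \<subseteq> K" "J \<inter> T = K \<inter> T" for J K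
  proof
    fix x assume x: "x \<in> J"
    then have xc: "x \<in> carrier R" using that ideal_carr by blast
    then obtain t where t: "t \<in> T" "x \<ominus> t \<in> I" using assms by blast
    then have "t \<in> carrier R" "x \<ominus> t \<in> J" "x \<ominus> t \<in> K" using assms that by auto
    then show "x \<in> K" using ideal_cong_mem_iff xc that x t by blast
  qed
  then have "inj_on (\<lambda>J. J \<inter> T) {J. ideal J R \<and> I \<subseteq> J}"
    by (intro inj_onI) blast
  moreover have "finite ((\<lambda>J. J \<inter> T) ` {J. ideal J R \<and> I \<subseteq> J})"
    by (rule finite_subset[of _ "Pow T"]) (use assms(2) in auto)
  ultimately show ?thesis using finite_image_iff by blast
qed

text \<open>\<open>A n\<close> is the contraction of the ideal generated by \<open>y ^ n\<close> in the localisation of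
  \<open>R / P\<^sub>0\<close> at \<open>P\<close>.\<close>

lemma krull_principal_ideal:
  assumes primes: "primeideal P\<^sub>0 R" "primeideal P R" "P\<^sub>0 \<subset> P" "P \<noteq> m"
    and x: "x \<in> m" "\<And>Q. primeideal Q R \<Longrightarrow> x \<in> Q \<Longrightarrow> Q = m"
  shows False
proof -
  obtain y where y: "y \<in> P" "y \<notin> P\<^sub>0" using primes by blast
  note ideals = prime_ideal[OF primes(1)] prime_ideal[OF primes(2)]
  have c: "x \<in> carrier R" "y \<in> carrier R" using x(1) y(1) m_ideal ideals ideal_carr by auto
  have xP: "x \<notin> P" using x(2) primes by blast
  have prodP: "s \<otimes> t \<notin> P" if "s \<in> carrier R - P" "t \<in> carrier R - P" for s t
    using prime_dest[OF primes(2)] that by blast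
  define A where "A n = {r \<in> carrier R. \<exists>s\<in>carrier R - P. \<exists>a\<in>carrier R. s \<otimes> r \<ominus> a \<otimes> y [^] n \<in> P\<^sub>0}" for n :: nat
  have AI: "ideal (A n) R" for n
  proof (rule ideal_closedI)
    have "\<one> \<otimes> \<zero> \<ominus> \<zero> \<otimes> y [^] n = \<zero>" using c by simp
    then show "\<zero> \<in> A n" unfolding A_def using ideal_zero[OF ideals(1)] one_notin_prime[OF primes(2)]
      by (metis (mono_tags, lifting) DiffI mem_Collect_eq one_closed zero_closed)
    fix r r' assume "r \<in> A n" "r' \<in> A n"
    then obtain s a s' a' where *: "r \<in> carrier R" "s \<in> carrier R - P" "a \<in> carrier R"
        "s \<otimes> r \<ominus> a \<otimes> y [^] n \<in> P\<^sub>0" "r' \<in> carrier R" "s' \<in> carrier R - P" "a' \<in> carrier R"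
        "s' \<otimes> r' \<ominus> a' \<otimes> y [^] n \<in> P\<^sub>0"
      unfolding A_def by blast
    \<comment> \<open>Fractions are added over the common denominator \<open>s * s'\<close>.\<close>
    have "(s \<otimes> s') \<otimes> (r \<oplus> r') \<ominus> (s' \<otimes> a \<oplus> s \<otimes> a') \<otimes> y [^] n
      = s' \<otimes> (s \<otimes> r \<ominus> a \<otimes> y [^] n) \<oplus> s \<otimes> (s' \<otimes> r' \<ominus> a' \<otimes> y [^] n)"
    proof -
      have sc: "s \<in> carrier R" "s' \<in> carrier R" using * by auto
      have "\<And>z. z \<in> carrier R \<Longrightarrow> (s \<otimes> s') \<otimes> (r \<oplus> r') \<ominus> (s' \<otimes> a \<oplus> s \<otimes> a') \<otimes> z
        = s' \<otimes> (s \<otimes> r \<ominus> a \<otimes> z) \<oplus> s \<otimes> (s' \<otimes> r' \<ominus> a' \<otimes> z)"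
        using sc *(1,3,5,7) by algebra
      then show ?thesis using c(2) by simp
    qed
    also have "\<dots> \<in> P\<^sub>0" using * ideals(1) by (intro ideal_add ideal_mult) auto
    finally show "r \<oplus> r' \<in> A n" unfolding A_def using * prodP[OF *(2,6)] by blast
  next
    fix t r assume tr: "t \<in> carrier R" "r \<in> A n"
    then obtain s a where *: "r \<in> carrier R" "s \<in> carrier R - P" "a \<in> carrier R"
        "s \<otimes> r \<ominus> a \<otimes> y [^] n \<in> P\<^sub>0" unfolding A_def by blast
    have "s \<otimes> (t \<otimes> r) \<ominus> (t \<otimes> a) \<otimes> y [^] n = t \<otimes> (s \<otimes> r \<ominus> a \<otimes> y [^] n)"
    proof -
      have sc: "s \<in> carrier R" using * by auto
      have "\<And>z. z \<in> carrier R \<Longrightarrow> s \<otimes> (t \<otimes> r) \<ominus> (t \<otimes> a) \<otimes> z = t \<otimes> (s \<otimes> r \<ominus> a \<otimes> z)"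
        using sc *(1,3) tr(1) by algebra
      then show ?thesis using c(2) by simp
    qed
    then have "s \<otimes> (t \<otimes> r) \<ominus> (t \<otimes> a) \<otimes> y [^] n \<in> P\<^sub>0" using * tr(1) ideal_mult[OF ideals(1)] by simp
    then show "t \<otimes> r \<in> A n" unfolding A_def using * tr(1) by blast
  qed (auto simp: A_def)
  have A_Suc: "A (Suc n) \<subseteq> A n" for n
  proof
    fix r assume "r \<in> A (Suc n)"
    then obtain s a where *: "r \<in> carrier R" "s \<in> carrier R - P" "a \<in> carrier R"
        "s \<otimes> r \<ominus> a \<otimes> y [^] Suc n \<in> P\<^sub>0" unfolding A_def by blast
    have "a \<otimes> y [^] Suc n = (a \<otimes> y) \<otimes> y [^] n" using * c(2) by (simp add: m_ac)
    then show "r \<in> A n" unfolding A_def using * c by auto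
  qed
  \<comment> \<open>Adding \<open>x\<close> moves the chain among the ideals above
    \<open>PIdl x\<close>, of which there are finitely many because \<open>m\<close> is the only
    prime over \<open>x\<close>.\<close>
  define B where "B n = A n <+>\<^bsub>R\<^esub> PIdl x" for n
  have BI: "ideal (B n) R" for n unfolding B_def using add_principal_ideal AI c by blast
  have Bdec: "B j \<subseteq> B i" if "i \<le> j" for i j
  proof -
    have "A j \<subseteq> A i" using lift_Suc_antimono_le[of A, OF A_Suc that] .
    then show ?thesis unfolding B_def subset_iff add_principal_iff by blast
  qed
  have "PIdl x \<subseteq> B n" for n
  proof
    fix z assume "z \<in> PIdl x"
    then obtain r where r: "r \<in> carrier R" "z = r \<otimes> x" by (auto simp: cgenideal_def)
    then have "z = \<zero> \<oplus> r \<otimes> x" using c(1) by simp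
    then show "z \<in> B n" unfolding B_def add_principal_iff using ideal_zero[OF AI] r(1) by blast
  qed
  moreover have "finite {J. ideal J R \<and> PIdl x \<subseteq> J}"
  proof -
    have "P = m" if "primeideal P R" "PIdl x \<subseteq> P" for P
      using x(2)[OF that(1)] that(2) cgenideal_self[OF c(1)] by blast
    then show ?thesis
      using finite_quotient[OF cgenideal_ideal[OF c(1)]] finite_ideals_above[OF cgenideal_ideal[OF c(1)]]
      by meson
  qed
  moreover have "range B \<subseteq> {J. ideal J R \<and> PIdl x \<subseteq> J}" using calculation(1) BI by blast
  ultimately have "finite (range B)" using finite_subset by blast
  \<comment> \<open>A repetition in a decreasing sequence gives two equal consecutive
    members.\<close>
  then have "\<not> inj B" using finite_imageD by blast
  then obtain i j where "i \<noteq> j" "B i = B j" by (auto simp: inj_def)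
  then obtain i j where ij: "i < j" "B i = B j" by (metis linorder_neqE_nat)
  then have Bi: "B i \<subseteq> B (Suc i)" using Bdec[of "Suc i" j] by auto
  \<comment> \<open>If \<open>b + t * x\<close> is in \<open>A i\<close> with \<open>b\<close> in
    \<open>A (Suc i)\<close>, then \<open>t\<close> is in \<open>A i\<close>, since \<open>x\<close>
    is a unit at \<open>P\<close>. So \<open>A i\<close> lies in \<open>A (Suc i) + m * A i\<close>,
    and Nakayama's lemma applies.\<close>
  have "A (Suc i) = A i"
  proof (rule ccontr)
    assume "A (Suc i) \<noteq> A i"
    then have "A (Suc i) \<subset> A i" using A_Suc by blast
    then obtain H where H: "ideal H R" "A (Suc i) \<subseteq> H" "H \<subset> A i"
        "\<And>x y. x \<in> m \<Longrightarrow> y \<in> A i \<Longrightarrow> x \<otimes> y \<in> H"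
      using maximal_proper_subideal[OF AI AI] by metis
    have "r \<in> H" if r: "r \<in> A i" for r
    proof -
      have rc: "r \<in> carrier R" using r AI ideal_carr by blast
      have "r = r \<oplus> \<zero> \<otimes> x" using rc c by simp
      then have "r \<in> B i" unfolding B_def add_principal_iff using r by blast
      then obtain b t where bt: "b \<in> A (Suc i)" "t \<in> carrier R" "r = b \<oplus> t \<otimes> x"
        using Bi unfolding B_def subset_iff add_principal_iff by blast
      have bc: "b \<in> carrier R" using bt AI ideal_carr by blast
      have "r \<ominus> b = t \<otimes> x" unfolding bt(3) using bc bt(2) c(1) by algebra
      then have "t \<otimes> x \<in> A i" using ideal_diff[OF AI r, of b] A_Suc bt(1) by auto
      then obtain s a where *: "s \<in> carrier R - P" "a \<in> carrier R"
          "s \<otimes> (t \<otimes> x) \<ominus> a \<otimes> y [^] i \<in> P\<^sub>0" unfolding A_def by blast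
      have "s \<otimes> (t \<otimes> x) = (s \<otimes> x) \<otimes> t" using * bt c by (simp add: m_ac)
      then have "t \<in> A i" unfolding A_def using * bt(2) prodP[OF *(1), of x] xP c by auto
      then have "x \<otimes> t \<in> H" using H(4) x(1) by blast
      then show ?thesis using bt H ideal_add c m_comm by (metis subsetD)
    qed
    then show False using H(3) by blast
  qed
  moreover have "y [^] i \<in> A i"
  proof -
    have "\<one> \<otimes> y [^] i \<ominus> \<one> \<otimes> y [^] i \<in> P\<^sub>0" using c ideal_zero[OF ideals(1)] by (simp add: a_minus_def r_neg)
    then show ?thesis unfolding A_def using c one_notin_prime[OF primes(2)] by blast
  qed
  \<comment> \<open>In the domain \<open>R / P\<^sub>0\<close> the factor \<open>y ^ i\<close>
    cancels, so \<open>s\<close> is congruent to \<open>a * y\<close>. As \<open>y\<close> is in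
    \<open>P\<close>, so is the denominator \<open>s\<close>.\<close>
  ultimately have "y [^] i \<in> A (Suc i)" by simp
  then obtain s a where *: "s \<in> carrier R - P" "a \<in> carrier R"
      "s \<otimes> y [^] i \<ominus> a \<otimes> y [^] Suc i \<in> P\<^sub>0" unfolding A_def by blast
  have sc: "s \<in> carrier R" using * by auto
  have "s \<otimes> y [^] i \<ominus> a \<otimes> y [^] Suc i = y [^] i \<otimes> (s \<ominus> a \<otimes> y)"
  proof -
    have "\<And>z. z \<in> carrier R \<Longrightarrow> s \<otimes> z \<ominus> a \<otimes> (z \<otimes> y) = z \<otimes> (s \<ominus> a \<otimes> y)"
      using sc *(2) c(2) by algebra
    then show ?thesis using c(2) by simp
  qed
  then have "y [^] i \<in> P\<^sub>0 \<or> s \<ominus> a \<otimes> y \<in> P\<^sub>0"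
    using * prime_dest[OF primes(1), of "y [^] i" "s \<ominus> a \<otimes> y"] c sc by auto
  then have "s \<ominus> a \<otimes> y \<in> P" using prime_power_dest[OF primes(1) c(2)] y primes(3) by blast
  then have "s \<in> P" 
    using ideal_cong_mem_iff[OF ideals(2), of s "a \<otimes> y"] ideal_mult[OF ideals(2) *(2) y(1)] * c sc by auto
  then show False using * by blast
qed

section \<open>Primes directly below the maximal ideal\<close>

text \<open>These are the primes with \<open>dim (R / P) = 1\<close>. Two different ones are never
  comparable.\<close>

definition coheight_one :: "'a set set" where
  "coheight_one = {P. primeideal P R \<and> P \<noteq> m \<and> (\<forall>Q. primeideal Q R \<longrightarrow> P \<subseteq> Q \<longrightarrow> Q = P \<or> Q = m)}"

lemma subset_coheight_one:
  assumes "primeideal Q R" "Q \<noteq> m"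
  obtains P where "P \<in> coheight_one" "Q \<subseteq> P"
proof -
  let ?S = "{P. primeideal P R \<and> P \<noteq> m \<and> Q \<subseteq> P}"
  have "\<exists>P\<in>?S. \<forall>J\<in>?S. P \<subseteq> J \<longrightarrow> J = P"
    by (rule ideal_family_maximal) (use assms prime_ideal in auto)
  then obtain P where "P \<in> ?S" "\<forall>J\<in>?S. P \<subseteq> J \<longrightarrow> J = P" by blast
  then have "P \<in> coheight_one" "Q \<subseteq> P" unfolding coheight_one_def by auto
  then show thesis using that by blast
qed

text \<open>If there were finitely many, some \<open>x\<close> in \<open>m\<close> would avoid them
  all. Then \<open>m\<close> is the only prime over \<open>x\<close>, and a chain of length two
  contradicts the principal ideal theorem.\<close>

lemma infinite_coheight_one:
  assumes "has_prime_chain R 2"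
  shows "infinite coheight_one"
proof
  assume fin: "finite coheight_one"
  have "\<not> m \<subseteq> P" if "P \<in> coheight_one" for P
    using that prime_subset_m unfolding coheight_one_def by blast
  moreover have "primeideal P R" if "P \<in> coheight_one" for P
    using that unfolding coheight_one_def by simp
  \<comment> \<open>The coset of zero gives ordinary prime avoidance.\<close>
  ultimately obtain x where x: "x \<in> m" "\<forall>P\<in>coheight_one. \<zero> \<oplus> x \<notin> P"
    using coset_prime_avoidance[OF fin _ m_ideal _ zero_closed] by blast
  then have "\<forall>P\<in>coheight_one. x \<notin> P" using ideal_carr[OF m_ideal] by simp
  then have only_m: "Q = m" if "primeideal Q R" "x \<in> Q" for Q
    using subset_coheight_one[OF that(1)] that(2) by blast
  obtain F where F: "\<And>i. i \<le> 2 \<Longrightarrow> primeideal (F i) R" "\<And>i. i < 2 \<Longrightarrow> F i \<subset> F (Suc i)"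
    using assms unfolding has_prime_chain_def by blast
  have "F 1 \<subset> F 2" using F(2)[of 1] by (simp add: numeral_2_eq_2)
  then have "F 1 \<noteq> m" using prime_subset_m[OF F(1)[of 2]] by auto
  then show False
    using krull_principal_ideal[OF F(1)[of 0] F(1)[of 1] _ _ x(1) only_m] F(2)[of 0] by auto
qed

lemma primary_to_m:
  assumes "ideal I R" "I \<subseteq> m" "\<And>Q. primeideal Q R \<Longrightarrow> I \<subseteq> Q \<Longrightarrow> Q = m"
  shows "primary_to R m I"
proof -
  have power: "\<exists>k::nat. x [^] k \<in> I" if "x \<in> m" for x
    using power_mem_of_primes[OF assms(1)] assms(3) that ideal_carr[OF m_ideal] by blast
  have "a \<in> I" if "a \<in> carrier R" "b \<in> carrier R" "a \<otimes> b \<in> I" "b \<notin> m" for a b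
    using mem_of_mult_outside_m[OF assms(1), of b a] that by (simp add: m_comm)
  then have "primary_ideal R I"
    unfolding primary_ideal_def using power assms(1,2) one_notin_prime[OF m_prime] one_closed by blast
  moreover have "radical_ideal R I = m"
    unfolding radical_ideal_def
    using power prime_power_dest[OF m_prime] assms(2) ideal_carr[OF m_ideal] by blast
  ultimately show ?thesis unfolding primary_to_def by blast
qed

section \<open>Vectors over the residue field\<close>

text \<open>Fixed representatives and extensionality make each nonzero residue vector occur exactly
  once, on which the count of generators relies. Proportional vectors remain different
  indices.\<close>

definition nonzero_vectors :: "nat \<Rightarrow> (nat \<Rightarrow> 'a) set" where
  "nonzero_vectors n = {c \<in> {..<n} \<rightarrow>\<^sub>E rep ` carrier R. \<exists>i<n. c i \<notin> m}"

lemma nonzero_vectors_closed: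
  assumes "c \<in> nonzero_vectors n" "i < n"
  shows "c i \<in> carrier R"
proof -
  have "c \<in> {..<n} \<rightarrow>\<^sub>E rep ` carrier R" 
    using assms(1) unfolding nonzero_vectors_def by simp
  then have "c i \<in> rep ` carrier R" using assms(2) by (rule PiE_mem[OF _ lessThan_iff[THEN iffD2]])
  then show ?thesis by (rule imageE) (simp add: rep_closed)
qed

lemma nonzero_vectors_rep:
  assumes "c \<in> nonzero_vectors n" "i < n"
  shows "rep (c i) = c i"
proof -
  have "c \<in> {..<n} \<rightarrow>\<^sub>E rep ` carrier R" 
    using assms(1) unfolding nonzero_vectors_def by simp
  then have "c i \<in> rep ` carrier R" using assms(2) by (rule PiE_mem[OF _ lessThan_iff[THEN iffD2]])
  then show ?thesis by (rule imageE) (simp add: rep_rep)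
qed

lemma rep_zero_iff: "x \<in> carrier R \<Longrightarrow> rep x = rep \<zero> \<longleftrightarrow> x \<in> m"
  by (simp add: rep_eq_iff a_minus_def)

lemma nonzero_vectors_eq:
  "nonzero_vectors n = ({..<n} \<rightarrow>\<^sub>E rep ` carrier R) - {\<lambda>i\<in>{..<n}. rep \<zero>}"
proof -
  have "c = (\<lambda>i\<in>{..<n}. rep \<zero>)"
    if c: "c \<in> {..<n} \<rightarrow>\<^sub>E rep ` carrier R" "\<forall>i<n. c i \<in> m" for c
  proof (rule extensionalityI[of _ "{..<n}"])
    fix i assume i: "i \<in> {..<n}"
    then obtain x where x: "x \<in> carrier R" "c i = rep x" using c(1) by blast
    then have "rep x = rep \<zero>" using rep_zero_iff rep_closed rep_rep c(2) i by (metis lessThan_iff)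
    then show "c i = (\<lambda>i\<in>{..<n}. rep \<zero>) i" using x i by simp
  qed (use c in \<open>auto simp: PiE_def\<close>)
  moreover have "rep \<zero> \<in> m" using rep_zero_iff[OF rep_closed[of \<zero>]] rep_rep[of \<zero>] by simp
  ultimately show ?thesis unfolding nonzero_vectors_def by auto
qed

lemma finite_nonzero_vectors: "finite (nonzero_vectors n)"
  unfolding nonzero_vectors_eq using finite_reps by (simp add: finite_PiE)

section \<open>Coefficients modulo a prime\<close>

text \<open>For ideals \<open>S\<close> and \<open>P\<close> this is \<open>S * v + P\<close>. It is
  used with \<open>S\<close> the whole ring and with \<open>S = m\<close>.\<close>

definition multiples_mod :: "'a set \<Rightarrow> 'a \<Rightarrow> 'a set \<Rightarrow> 'a set" where
  "multiples_mod S v P = {z \<in> carrier R. \<exists>r\<in>S. z \<ominus> r \<otimes> v \<in> P}"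

lemma multiples_mod_ideal:
  assumes "ideal S R" "v \<in> carrier R" "ideal P R"
  shows "ideal (multiples_mod S v P) R"
proof (rule ideal_closedI)
  note Sc = ideal_carr[OF assms(1)]
  have "\<zero> \<ominus> \<zero> \<otimes> v = \<zero>" using assms(2) by simp
  then show "\<zero> \<in> multiples_mod S v P"
    unfolding multiples_mod_def using assms(1,3) ideal_zero
    by (metis (mono_tags, lifting) mem_Collect_eq zero_closed)
  fix x assume "x \<in> multiples_mod S v P"
  then obtain r where r: "x \<in> carrier R" "r \<in> S" "x \<ominus> r \<otimes> v \<in> P" unfolding multiples_mod_def by blast
  show "x \<oplus> y \<in> multiples_mod S v P" if y: "y \<in> multiples_mod S v P" for y
  proof -
    obtain s where s: "y \<in> carrier R" "s \<in> S" "y \<ominus> s \<otimes> v \<in> P"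
      using y unfolding multiples_mod_def by blast
    have "(x \<oplus> y) \<ominus> (r \<otimes> v \<oplus> s \<otimes> v) \<in> P"
      using r s assms Sc by (intro ideal_cong_add) auto
    moreover have "r \<otimes> v \<oplus> s \<otimes> v = (r \<oplus> s) \<otimes> v" using r s assms(2) Sc by (simp add: l_distr)
    ultimately show ?thesis
      unfolding multiples_mod_def using r(1,2) s(1,2) ideal_add[OF assms(1)] by force
  qed
  show "t \<otimes> x \<in> multiples_mod S v P" if t: "t \<in> carrier R" for t
  proof -
    have "t \<otimes> (x \<ominus> r \<otimes> v) \<in> P" using r t assms ideal_mult by blast
    moreover have "t \<otimes> (x \<ominus> r \<otimes> v) = t \<otimes> x \<ominus> (t \<otimes> r) \<otimes> v"
      using t r(1) Sc[OF r(2)] assms(2) by algebra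
    ultimately show ?thesis
      unfolding multiples_mod_def using r(1,2) t ideal_mult[OF assms(1)] by force
  qed
qed (auto simp: multiples_mod_def)

text \<open>A coefficient from the ideal \<open>S\<close> in one factor keeps the coefficient of the
  product in \<open>S\<close>. This carries containment in \<open>m * u c\<close> from
  \<open>J\<close> to \<open>J * I ^ t\<close>.\<close>

lemma ideal_prod_multiples_mod:
  assumes "ideal S R" "u \<in> carrier R" "v \<in> carrier R" "ideal P R"
    "I \<subseteq> multiples_mod S u P" "J \<subseteq> multiples_mod (carrier R) v P"
  shows "ideal_prod R I J \<subseteq> multiples_mod S (u \<otimes> v) P"
proof
  have D: "ideal (multiples_mod S (u \<otimes> v) P) R" using assms by (simp add: multiples_mod_ideal)
  fix z assume "z \<in> ideal_prod R I J"
  then show "z \<in> multiples_mod S (u \<otimes> v) P"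
  proof (induction rule: ideal_prod.induct)
    case (prod i j)
    obtain r where r: "i \<in> carrier R" "r \<in> S" "i \<ominus> r \<otimes> u \<in> P"
      using assms(5) prod(1) unfolding multiples_mod_def by blast
    obtain s where s: "j \<in> carrier R" "s \<in> carrier R" "j \<ominus> s \<otimes> v \<in> P"
      using assms(6) prod(2) unfolding multiples_mod_def by blast
    have rc: "r \<in> carrier R" using r(2) assms(1) ideal_carr by blast
    have "i \<otimes> j \<ominus> (r \<otimes> u) \<otimes> (s \<otimes> v) \<in> P"
      using r s rc assms by (intro ideal_cong_mult) auto
    moreover have "(r \<otimes> u) \<otimes> (s \<otimes> v) = (s \<otimes> r) \<otimes> (u \<otimes> v)"
      using s rc assms(2,3) by (simp add: m_ac)
    ultimately show ?case
      unfolding multiples_mod_def using r(1,2) s(1,2) ideal_mult[OF assms(1)] by force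
  next
    case (sum s1 s2)
    then show ?case using ideal_add[OF D] by blast
  qed
qed

text \<open>It lets two coefficients be compared on generators only, one along \<open>u\<close>
  modulo \<open>P\<close> and one along \<open>v\<close> modulo \<open>Q\<close>. Below,
  \<open>Q\<close> is once a hyperplane \<open>H\<close> and once a second prime
  \<open>P d\<close>.\<close>

lemma common_multiples_mod_ideal:
  assumes "u \<in> carrier R" "v \<in> carrier R" "ideal P R" "ideal Q R"
  shows "ideal {z \<in> carrier R. \<exists>r\<in>carrier R. \<exists>s\<in>carrier R.
    r \<ominus> s \<in> m \<and> z \<ominus> r \<otimes> u \<in> P \<and> z \<ominus> s \<otimes> v \<in> Q} R" (is "ideal ?W R")
proof (rule ideal_closedI)
  have "\<zero> \<ominus> \<zero> \<otimes> u \<in> P" "\<zero> \<ominus> \<zero> \<otimes> v \<in> Q" "\<zero> \<ominus> \<zero> \<in> m"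
    using assms m_ideal ideal_zero by (simp_all add: a_minus_def)
  then show "\<zero> \<in> ?W" by blast
  fix x assume "x \<in> ?W"
  then obtain r s where x: "x \<in> carrier R" "r \<in> carrier R" "s \<in> carrier R" "r \<ominus> s \<in> m"
    "x \<ominus> r \<otimes> u \<in> P" "x \<ominus> s \<otimes> v \<in> Q" by blast
  show "x \<oplus> y \<in> ?W" if yW: "y \<in> ?W" for y
  proof -
    obtain r' s' where y: "y \<in> carrier R" "r' \<in> carrier R" "s' \<in> carrier R" "r' \<ominus> s' \<in> m"
      "y \<ominus> r' \<otimes> u \<in> P" "y \<ominus> s' \<otimes> v \<in> Q" using yW by blast
    have "(r \<oplus> r') \<ominus> (s \<oplus> s') \<in> m" "(x \<oplus> y) \<ominus> (r \<otimes> u \<oplus> r' \<otimes> u) \<in> P"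
      "(x \<oplus> y) \<ominus> (s \<otimes> v \<oplus> s' \<otimes> v) \<in> Q"
      using x y assms m_ideal by (auto intro!: ideal_cong_add)
    then have "(r \<oplus> r') \<ominus> (s \<oplus> s') \<in> m" "(x \<oplus> y) \<ominus> (r \<oplus> r') \<otimes> u \<in> P"
      "(x \<oplus> y) \<ominus> (s \<oplus> s') \<otimes> v \<in> Q"
      using x(1-3) y(1-3) assms(1,2) by (simp_all add: l_distr)
    then show ?thesis using x(1-3) y(1-3) by blast
  qed
  show "t \<otimes> x \<in> ?W" if t: "t \<in> carrier R" for t
  proof -
    have "t \<otimes> (r \<ominus> s) \<in> m" "t \<otimes> (x \<ominus> r \<otimes> u) \<in> P" "t \<otimes> (x \<ominus> s \<otimes> v) \<in> Q"
      using x t assms m_ideal ideal_mult by auto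
    moreover have "t \<otimes> (r \<ominus> s) = t \<otimes> r \<ominus> t \<otimes> s" 
      "t \<otimes> (x \<ominus> r \<otimes> u) = t \<otimes> x \<ominus> (t \<otimes> r) \<otimes> u"
      "t \<otimes> (x \<ominus> s \<otimes> v) = t \<otimes> x \<ominus> (t \<otimes> s) \<otimes> v"
      using x(1-3) t assms(1,2) by algebra+
    ultimately have "t \<otimes> r \<ominus> t \<otimes> s \<in> m" "t \<otimes> x \<ominus> (t \<otimes> r) \<otimes> u \<in> P"
      "t \<otimes> x \<ominus> (t \<otimes> s) \<otimes> v \<in> Q" by simp_all
    then show ?thesis using x(1-3) t by blast
  qed
qed auto

text \<open>\<open>R / P\<close> is a domain and \<open>P\<close> lies in \<open>m\<close>, so the
  residue of a coefficient along \<open>v\<close> is well defined.\<close>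

lemma cancel_mod_prime:
  assumes "primeideal P R" "v \<in> carrier R" "v \<notin> P" "r \<in> carrier R" "s \<in> carrier R"
    "z \<in> carrier R" "z \<ominus> r \<otimes> v \<in> P" "z \<ominus> s \<otimes> v \<in> P"
  shows "r \<ominus> s \<in> m"
proof -
  have "r \<otimes> v \<ominus> s \<otimes> v \<in> P"
    using assms prime_ideal ideal_cong_trans[of P "r \<otimes> v" z "s \<otimes> v"] ideal_cong_sym[of P z "r \<otimes> v"]
    by auto
  moreover have "r \<otimes> v \<ominus> s \<otimes> v = (r \<ominus> s) \<otimes> v" using assms(2,4,5) by algebra
  ultimately show ?thesis
    using prime_dest[OF assms(1), of "r \<ominus> s" v] prime_subset_m[OF assms(1)] assms(2-5) by auto
qed

end

section \<open>Ideals without proper reductions\<close>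

text \<open>Every nonzero linear form on residue vectors, given by its coefficients
  \<open>c\<close>, is realised by the generators in the domain \<open>R / P c\<close>, up to the
  factor \<open>u c\<close>.\<close>

locale rational_point_ideal = finite_residue_local_ring R m for R (structure) and m +
  fixes n :: nat and P :: "(nat \<Rightarrow> 'a) \<Rightarrow> 'a set" and u :: "(nat \<Rightarrow> 'a) \<Rightarrow> 'a" and a :: "nat \<Rightarrow> 'a"
  assumes P_prime: "c \<in> nonzero_vectors n \<Longrightarrow> primeideal (P c) R"
    and u_closed: "c \<in> nonzero_vectors n \<Longrightarrow> u c \<in> carrier R"
    and u_notin: "c \<in> nonzero_vectors n \<Longrightarrow> u c \<notin> P c"
    and a_closed: "i < n \<Longrightarrow> a i \<in> carrier R"
    and a_cong: "c \<in> nonzero_vectors n \<Longrightarrow> i < n \<Longrightarrow> a i \<ominus> c i \<otimes> u c \<in> P c"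
begin

abbreviation I where "I \<equiv> Idl\<^bsub>R\<^esub> (a ` {..<n})"

lemma I_ideal: "ideal I R"
  using a_closed by (intro genideal_ideal) auto

lemma a_in_I: "i < n \<Longrightarrow> a i \<in> I"
  using genideal_self[of "a ` {..<n}"] a_closed by auto

lemma I_subset: "ideal J R \<Longrightarrow> (\<And>i. i < n \<Longrightarrow> a i \<in> J) \<Longrightarrow> I \<subseteq> J"
  by (intro genideal_minimal) auto

lemma I_subset_multiples:
  assumes "c \<in> nonzero_vectors n"
  shows "I \<subseteq> multiples_mod (carrier R) (u c) (P c)"
proof (rule I_subset)
  show "ideal (multiples_mod (carrier R) (u c) (P c)) R"
    using multiples_mod_ideal oneideal u_closed P_prime prime_ideal assms by blast
  show "a i \<in> multiples_mod (carrier R) (u c) (P c)" if "i < n" for i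
    unfolding multiples_mod_def using a_closed a_cong nonzero_vectors_closed assms that by blast
qed

lemma not_I_subset_m_multiples:
  assumes "c \<in> nonzero_vectors n"
  shows "\<not> I \<subseteq> multiples_mod m (u c) (P c)"
proof
  assume sub: "I \<subseteq> multiples_mod m (u c) (P c)"
  obtain i where i: "i < n" "c i \<notin> m" using assms unfolding nonzero_vectors_def by blast
  then obtain r where r: "r \<in> m" "a i \<ominus> r \<otimes> u c \<in> P c"
    using sub a_in_I unfolding multiples_mod_def by blast
  have "r \<in> carrier R" using r m_ideal ideal_carr by blast
  moreover from this have "c i \<ominus> r \<in> m"
    using cancel_mod_prime[OF P_prime[OF assms] u_closed[OF assms] u_notin[OF assms]
        nonzero_vectors_closed[OF assms i(1)] _ a_closed[OF i(1)] a_cong[OF assms i(1)] r(2)] by blast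
  ultimately show False
    using ideal_cong_mem_iff[OF m_ideal, of "c i" r] nonzero_vectors_closed[OF assms i(1)] r(1) i(2) by blast
qed

lemma power_in_ideal_pow:
  assumes "x \<in> I"
  shows "x [^] k \<in> ideal_pow R I k"
proof (induction k)
  case (Suc k)
  have "x \<otimes> x [^] k \<in> ideal_pow R I (Suc k)" using ideal_prod.prod[OF assms Suc] by simp
  then show ?case using ideal_carr[OF I_ideal assms] by (simp add: m_comm)
qed simp

lemma ideal_pow_subset_multiples:
  assumes "c \<in> nonzero_vectors n"
  shows "ideal_pow R I k \<subseteq> multiples_mod (carrier R) (u c [^] k) (P c)"
proof (induction k)
  case 0
  have "x \<ominus> x \<otimes> \<one> \<in> P c" if "x \<in> carrier R" for x
    using that ideal_zero prime_ideal P_prime assms by (simp add: a_minus_def r_neg)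
  then show ?case by (auto simp: multiples_mod_def)
next
  case (Suc k)
  have "u c [^] Suc k = u c \<otimes> u c [^] k" using u_closed[OF assms] by (simp add: m_comm)
  then show ?case
    using ideal_prod_multiples_mod[OF oneideal _ _ _ I_subset_multiples[OF assms] Suc]
      u_closed[OF assms] prime_ideal[OF P_prime[OF assms]] by simp
qed

lemma no_proper_reduction: "\<not> has_proper_reduction R I"
proof
  assume "has_proper_reduction R I"
  then obtain J t where J: "ideal J R" "J \<subset> I" 
      and red: "ideal_pow R I (Suc t) = ideal_prod R J (ideal_pow R I t)"
    unfolding has_proper_reduction_def is_reduction_def by blast
  \<comment> \<open>The quotient \<open>I / H\<close> is one-dimensional over the residue field, so
    \<open>H\<close> is a hyperplane of \<open>I / m I\<close>; \<open>a l\<close> will span the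
    quotient.\<close>
  obtain H where H: "ideal H R" "J \<subseteq> H" "H \<subset> I"
    "\<And>x y. x \<in> m \<Longrightarrow> y \<in> I \<Longrightarrow> x \<otimes> y \<in> H"
    "\<And>y z. y \<in> I \<Longrightarrow> y \<notin> H \<Longrightarrow> z \<in> I \<Longrightarrow> \<exists>r\<in>carrier R. z \<ominus> r \<otimes> y \<in> H"
    using maximal_proper_subideal[OF I_ideal J] by metis
  obtain l where l: "l < n" "a l \<notin> H" using I_subset[OF H(1)] H(3) by blast
  have al: "a l \<in> carrier R" using a_closed l by blast
  \<comment> \<open>Coefficients may be replaced by representatives, because \<open>m * I\<close>
    lies in \<open>H\<close>.\<close>
  have "\<exists>r\<in>rep ` carrier R. a i \<ominus> r \<otimes> a l \<in> H" if i: "i < n" for i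
  proof -
    obtain r where r: "r \<in> carrier R" "a i \<ominus> r \<otimes> a l \<in> H" using H(5) a_in_I l i by blast
    have "(r \<ominus> rep r) \<otimes> a l \<in> H" using H(4) rep_cong r(1) a_in_I l(1) by blast
    moreover have "(r \<ominus> rep r) \<otimes> a l = r \<otimes> a l \<ominus> rep r \<otimes> a l"
      using r(1) rep_closed[OF r(1)] al by algebra
    ultimately have "a i \<ominus> rep r \<otimes> a l \<in> H"
      using ideal_cong_trans[OF H(1) r(2)] r(1) rep_closed al a_closed i by simp
    then show ?thesis using r(1) by blast
  qed
  then obtain f where f: "\<And>i. i < n \<Longrightarrow> f i \<in> rep ` carrier R \<and> a i \<ominus> f i \<otimes> a l \<in> H" by metis
  \<comment> \<open>The linear form with kernel \<open>H\<close>, normalised at \<open>a l\<close>;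
    restriction makes it extensional, as the index set requires.\<close>
  define c where "c = restrict f {..<n}"
  have cH: "a i \<ominus> c i \<otimes> a l \<in> H" if "i < n" for i using f that by (simp add: c_def)
  have "c l \<notin> m"
  proof
    assume "c l \<in> m"
    then have "c l \<otimes> a l \<in> H" "c l \<otimes> a l \<in> carrier R"
      using H(4) a_in_I l(1) al ideal_carr[OF m_ideal] by auto
    then show False using ideal_cong_mem_iff[OF H(1) cH[OF l(1)] al] l(2) by blast
  qed
  then have c: "c \<in> nonzero_vectors n"
    unfolding nonzero_vectors_def using f l(1) by (auto simp: c_def)
  have cl: "c l \<in> carrier R" using nonzero_vectors_closed[OF c l(1)] .
  note Pc = P_prime[OF c] and uc = u_closed[OF c]
  \<comment> \<open>Here the coefficient modulo \<open>P c\<close> and the value of the linear form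
    have the same residue. On the generator \<open>a i\<close>, \<open>c i\<close> serves as both,
    so \<open>?W\<close> contains \<open>I\<close>.\<close>
  let ?W = "{z \<in> carrier R. \<exists>r\<in>carrier R. \<exists>s\<in>carrier R.
    r \<ominus> s \<in> m \<and> z \<ominus> r \<otimes> u c \<in> P c \<and> z \<ominus> s \<otimes> a l \<in> H}"
  have "I \<subseteq> ?W"
  proof (rule I_subset)
    show "ideal ?W R" using common_multiples_mod_ideal[OF uc al prime_ideal[OF Pc] H(1)] .
    fix i assume i: "i < n"
    have "c i \<in> carrier R" using nonzero_vectors_closed[OF c i] .
    moreover from this have "c i \<ominus> c i \<in> m" using ideal_zero[OF m_ideal] by (simp add: a_minus_def r_neg)
    ultimately show "a i \<in> ?W" using a_closed[OF i] a_cong[OF c i] cH[OF i] by blast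
  qed
  \<comment> \<open>The linear form vanishes on \<open>J\<close>, which lies in \<open>H\<close>, so
    the coefficient modulo \<open>P c\<close> is in \<open>m\<close>.\<close>
  have "J \<subseteq> multiples_mod m (u c) (P c)"
  proof
    fix z assume z: "z \<in> J"
    then obtain r s where rs: "z \<in> carrier R" "r \<in> carrier R" "s \<in> carrier R" "r \<ominus> s \<in> m"
        "z \<ominus> r \<otimes> u c \<in> P c" "z \<ominus> s \<otimes> a l \<in> H"
      using J(2) \<open>I \<subseteq> ?W\<close> by blast
    have "s \<otimes> a l \<in> H" using ideal_cong_mem_iff[OF H(1) rs(6)] rs al z H(2) by auto
    then have "s \<in> m" using mem_of_mult_outside_m[OF H(1) rs(3) _ al] l(2) by blast
    then have "r \<in> m" using ideal_cong_mem_iff[OF m_ideal rs(4)] rs by blast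
    then show "z \<in> multiples_mod m (u c) (P c)" unfolding multiples_mod_def using rs by blast
  qed
  then have "ideal_pow R I (Suc t) \<subseteq> multiples_mod m (u c \<otimes> u c [^] t) (P c)"
    unfolding red using ideal_prod_multiples_mod[OF m_ideal] ideal_pow_subset_multiples[OF c]
      uc prime_ideal[OF Pc] by simp
  moreover have "u c \<otimes> u c [^] t = u c [^] Suc t" using uc by (simp add: m_comm)
  \<comment> \<open>The reduction equation gives the power of \<open>a l\<close> a coefficient in
    \<open>m\<close>, while the congruence for \<open>a l\<close> gives it
    \<open>c l ^ (t + 1)\<close>, which is outside \<open>m\<close>.\<close>
  ultimately obtain r where r: "r \<in> m" "a l [^] Suc t \<ominus> r \<otimes> u c [^] Suc t \<in> P c"
    using power_in_ideal_pow[OF a_in_I[OF l(1)], of "Suc t"] unfolding multiples_mod_def by auto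
  have "a l [^] Suc t \<ominus> (c l \<otimes> u c) [^] Suc t \<in> P c"
    by (intro ideal_cong_power prime_ideal[OF Pc] a_cong c l(1) al m_closed cl uc)
  then have "a l [^] Suc t \<ominus> c l [^] Suc t \<otimes> u c [^] Suc t \<in> P c"
    using nat_pow_distrib[OF cl uc, of "Suc t"] by argo
  moreover have "u c [^] Suc t \<notin> P c" using prime_power_dest[OF Pc uc] u_notin[OF c] by blast
  moreover have rc: "r \<in> carrier R" using r m_ideal ideal_carr by blast
  ultimately have "c l [^] Suc t \<ominus> r \<in> m"
    using cancel_mod_prime[OF Pc, of "u c [^] Suc t" "c l [^] Suc t" r "a l [^] Suc t"] r(2) uc cl al
    by simp
  then have "c l [^] Suc t \<in> m" 
    using ideal_cong_mem_iff[OF m_ideal, of "c l [^] Suc t" r] rc cl r(1) by simp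
  then show False using prime_power_dest[OF m_prime cl] \<open>c l \<notin> m\<close> by blast
qed

text \<open>With \<open>q\<close> residue classes, each \<open>c\<close> yields the vector of
  coefficients of \<open>S\<close> modulo \<open>P c\<close>. This injects into the nonzero vectors
  indexed by \<open>S\<close>, whence \<open>q ^ n - 1 \<le> q ^ card S - 1\<close>.\<close>

lemma card_generators:
  assumes S: "S \<subseteq> carrier R" "finite S" "Idl\<^bsub>R\<^esub> S = I"
  shows "n \<le> card S"
proof -
  let ?T = "rep ` carrier R"
  have SI: "S \<subseteq> I" using genideal_self[OF S(1)] S(3) by simp
  have sub: "I \<subseteq> K" if "ideal K R" "S \<subseteq> K" for K using genideal_minimal[OF that] S(3) by simp
  have "\<exists>r\<in>carrier R. s \<ominus> r \<otimes> u c \<in> P c" if "c \<in> nonzero_vectors n" "s \<in> S" for c s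
    using I_subset_multiples[OF that(1)] SI that(2) unfolding multiples_mod_def by blast
  then obtain v where v: "\<And>c s. c \<in> nonzero_vectors n \<Longrightarrow> s \<in> S \<Longrightarrow>
      v c s \<in> carrier R \<and> s \<ominus> v c s \<otimes> u c \<in> P c" by metis
  define f where "f c = (\<lambda>s\<in>S. rep (v c s))" for c
  \<comment> \<open>Equal coefficients put \<open>S\<close>, and hence \<open>I\<close>, into
    \<open>?W\<close>; the coefficients of each \<open>a i\<close> then identify \<open>c i\<close>
    with \<open>d i\<close>.\<close>
  have "inj_on f (nonzero_vectors n)"
  proof (rule inj_onI)
    fix c d assume c: "c \<in> nonzero_vectors n" and d: "d \<in> nonzero_vectors n" and eq: "f c = f d"
    let ?W = "{z \<in> carrier R. \<exists>r\<in>carrier R. \<exists>s\<in>carrier R.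
      r \<ominus> s \<in> m \<and> z \<ominus> r \<otimes> u c \<in> P c \<and> z \<ominus> s \<otimes> u d \<in> P d}"
    have "I \<subseteq> ?W"
    proof (rule sub)
      show "ideal ?W R"
        using common_multiples_mod_ideal u_closed c d prime_ideal P_prime by blast
      show "S \<subseteq> ?W"
      proof
        fix s assume s: "s \<in> S"
        have "rep (v c s) = rep (v d s)" using fun_cong[OF eq, of s] s by (simp add: f_def)
        then have "v c s \<ominus> v d s \<in> m" using rep_eq_iff v c d s by blast
        then show "s \<in> ?W" using v[OF c s] v[OF d s] s S(1) by blast
      qed
    qed
    show "c = d"
    proof (rule extensionalityI[of _ "{..<n}"])
      fix i assume "i \<in> {..<n}"
      then have i: "i < n" by simp
      then obtain r s where rs: "r \<in> carrier R" "s \<in> carrier R" "r \<ominus> s \<in> m"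
        "a i \<ominus> r \<otimes> u c \<in> P c" "a i \<ominus> s \<otimes> u d \<in> P d" using \<open>I \<subseteq> ?W\<close> a_in_I by blast
      note cd = nonzero_vectors_closed[OF c i] nonzero_vectors_closed[OF d i]
      have "c i \<ominus> r \<in> m" "s \<ominus> d i \<in> m"
        using cancel_mod_prime[OF P_prime[OF c] u_closed[OF c] u_notin[OF c] cd(1) rs(1) a_closed[OF i] a_cong[OF c i] rs(4)]
          cancel_mod_prime[OF P_prime[OF d] u_closed[OF d] u_notin[OF d] rs(2) cd(2) a_closed[OF i] rs(5) a_cong[OF d i]]
        by blast+
      then have "c i \<ominus> d i \<in> m" using ideal_cong_trans[OF m_ideal] rs cd by blast
      then show "c i = d i" 
        using rep_eq_iff cd nonzero_vectors_rep c d i by metis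
    qed (use c d in \<open>auto simp: nonzero_vectors_def PiE_def\<close>)
  qed
  \<comment> \<open>A zero image would give all of \<open>I\<close> coefficients in
    \<open>m\<close>, against \<open>not_I_subset_m_multiples\<close>.\<close>
  moreover have "f ` nonzero_vectors n \<subseteq> (S \<rightarrow>\<^sub>E ?T) - {\<lambda>s\<in>S. rep \<zero>}"
  proof
    fix g assume "g \<in> f ` nonzero_vectors n"
    then obtain c where c: "c \<in> nonzero_vectors n" "g = f c" by blast
    have "f c \<noteq> (\<lambda>s\<in>S. rep \<zero>)"
    proof
      assume eq: "f c = (\<lambda>s\<in>S. rep \<zero>)"
      have "S \<subseteq> multiples_mod m (u c) (P c)"
      proof
        fix s assume s: "s \<in> S"
        have "rep (v c s) = rep \<zero>" using fun_cong[OF eq, of s] s by (simp add: f_def)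
        then have "v c s \<in> m" using rep_zero_iff v[OF c(1) s] by blast
        then show "s \<in> multiples_mod m (u c) (P c)"
          unfolding multiples_mod_def using v[OF c(1) s] s S(1) by blast
      qed
      then show False
        using not_I_subset_m_multiples[OF c(1)] 
          sub[OF multiples_mod_ideal[OF m_ideal u_closed[OF c(1)] prime_ideal[OF P_prime[OF c(1)]]]] by blast
    qed
    moreover have "f c \<in> S \<rightarrow>\<^sub>E ?T" using v[OF c(1)] by (simp add: f_def)
    ultimately show "g \<in> (S \<rightarrow>\<^sub>E ?T) - {\<lambda>s\<in>S. rep \<zero>}" using c(2) by simp
  qed
  moreover have fin: "finite (S \<rightarrow>\<^sub>E ?T)" by (intro finite_PiE S(2) finite_reps)
  ultimately have "card (nonzero_vectors n) \<le> card ((S \<rightarrow>\<^sub>E ?T) - {\<lambda>s\<in>S. rep \<zero>})"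
    using card_inj_on_le finite_Diff by metis
  moreover have "card (nonzero_vectors n) = card ?T ^ n - 1"
    unfolding nonzero_vectors_eq
    by (subst card_Diff_singleton) (auto simp: card_PiE)
  moreover have "card ((S \<rightarrow>\<^sub>E ?T) - {\<lambda>s\<in>S. rep \<zero>}) = card ?T ^ card S - 1"
    by (subst card_Diff_singleton) (auto simp: card_PiE S(2))
  moreover have two: "1 < card ?T"
  proof -
    have "card {rep \<zero>, rep \<one>} \<le> card ?T" using finite_reps by (intro card_mono) auto
    moreover have "rep \<one> \<noteq> rep \<zero>" using rep_zero_iff[of \<one>] one_notin_prime[OF m_prime] by simp
    ultimately show ?thesis by auto
  qed
  moreover have "0 < card ?T ^ n" "0 < card ?T ^ card S" using two by auto
  ultimately have "card ?T ^ n \<le> card ?T ^ card S" by linarith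
  then show ?thesis using two power_le_imp_le_exp by blast
qed

lemma minimally_generated: "minimally_generated_by R I n"
proof -
  have "a ` {..<n} \<subseteq> carrier R" using a_closed by auto
  \<comment> \<open>The \<open>a i\<close> are pairwise different, since fewer generators would
    contradict \<open>card_generators\<close>.\<close>
  moreover from this have "card (a ` {..<n}) = n"
    using card_generators[of "a ` {..<n}"] card_image_le[of "{..<n}" a] by simp
  ultimately show ?thesis unfolding minimally_generated_by_def using card_generators by blast
qed

end

section \<open>Construction of the generators\<close>

context finite_residue_local_ring
begin

lemma finsum_in_ideal:
  assumes "ideal I R" "finite A" "\<And>x. x \<in> A \<Longrightarrow> f x \<in> I"
  shows "finsum R f A \<in> I"
  using assms(2,3)
proof (induction A rule: finite_induct)
  case (insert x A)
  then have "f \<in> A \<rightarrow> carrier R" "f x \<in> carrier R" using ideal_carr[OF assms(1)] by auto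
  then show ?case using insert ideal_add[OF assms(1)] by simp
qed (use assms(1) ideal_zero in simp)

text \<open>As in the Chinese remainder theorem, \<open>u c\<close> is taken inside every chosen
  prime except \<open>P c\<close>, which incomparability permits. In \<open>b i\<close>, the sum of
  all \<open>c i * u c\<close>, only one term survives modulo \<open>P c\<close>.\<close>

lemma exists_interpolating_primes:
  assumes "infinite coheight_one"
  obtains P u b where "\<And>c. c \<in> nonzero_vectors n \<Longrightarrow> P c \<in> coheight_one"
    "\<And>c. c \<in> nonzero_vectors n \<Longrightarrow> u c \<in> carrier R"
    "\<And>c. c \<in> nonzero_vectors n \<Longrightarrow> u c \<notin> P c"
    "\<And>i. i < n \<Longrightarrow> b i \<in> m"
    "\<And>c i. c \<in> nonzero_vectors n \<Longrightarrow> i < n \<Longrightarrow> b i \<ominus> c i \<otimes> u c \<in> P c"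
proof -
  let ?X = "nonzero_vectors n"
  obtain C where C: "finite C" "card C = card ?X" "C \<subseteq> coheight_one"
    using infinite_arbitrarily_large[OF assms] by blast
  obtain P where P: "bij_betw P ?X C"
    using finite_same_card_bij[OF finite_nonzero_vectors C(1)] C(2) by metis
  have Pco: "P c \<in> coheight_one" if "c \<in> ?X" for c using P C(3) that bij_betwE by blast
  have PI: "ideal (P c) R" if "c \<in> ?X" for c
    using Pco[OF that] prime_ideal unfolding coheight_one_def by simp
  have "\<exists>z\<in>m. z \<notin> P c \<and> (\<forall>c'\<in>?X. c' \<noteq> c \<longrightarrow> z \<in> P c')" if c: "c \<in> ?X" for c
  proof -
    have prime: "primeideal (P c) R" "P c \<noteq> m" using Pco[OF c] unfolding coheight_one_def by auto
    have not: "\<not> P c' \<subseteq> P c" if "c' \<in> ?X" "c' \<noteq> c" for c'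
    proof -
      have "P c \<noteq> P c'" using P c that unfolding bij_betw_def inj_on_def by blast
      then show ?thesis using Pco[OF that(1)] prime unfolding coheight_one_def by blast
    qed
    \<comment> \<open>Including \<open>m\<close> puts every \<open>u c\<close>, and so every
      \<open>b i\<close>, into \<open>m\<close>.\<close>
    let ?A = "insert m (P ` (?X - {c}))"
    have "finite ?A" using finite_nonzero_vectors by simp
    moreover have "ideal J R" if "J \<in> ?A" for J using that m_ideal PI by auto
    moreover have "\<not> J \<subseteq> P c" if "J \<in> ?A" for J
      using that not prime prime_subset_m[OF prime(1)] by auto
    ultimately obtain z where "\<And>J. J \<in> ?A \<Longrightarrow> z \<in> J" "z \<notin> P c"
      using prime_avoids_ideals[OF _ _ prime(1)] by metis
    then show ?thesis by (intro bexI[of _ z]) auto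
  qed
  then obtain u where
    "\<forall>c\<in>?X. u c \<in> m \<and> u c \<notin> P c \<and> (\<forall>c'\<in>?X. c' \<noteq> c \<longrightarrow> u c \<in> P c')"
    using bchoice[of ?X "\<lambda>c z. z \<in> m \<and> z \<notin> P c \<and> (\<forall>c'\<in>?X. c' \<noteq> c \<longrightarrow> z \<in> P c')"] by blast
  then have u: "\<And>c. c \<in> ?X \<Longrightarrow> u c \<in> m" "\<And>c. c \<in> ?X \<Longrightarrow> u c \<notin> P c"
    "\<And>c c'. c \<in> ?X \<Longrightarrow> c' \<in> ?X \<Longrightarrow> c' \<noteq> c \<Longrightarrow> u c \<in> P c'" by blast+
  have uc: "u c \<in> carrier R" if "c \<in> ?X" for c using u(1)[OF that] ideal_carr[OF m_ideal] by blast
  define b where "b i = (\<Oplus>c\<in>?X. c i \<otimes> u c)" for i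
  show thesis
  proof (rule that[of P u b])
    show "b i \<in> m" if "i < n" for i
      unfolding b_def using m_ideal finite_nonzero_vectors u(1) nonzero_vectors_closed that
      by (intro finsum_in_ideal ideal_mult) auto
    show "b i \<ominus> c i \<otimes> u c \<in> P c" if c: "c \<in> ?X" and i: "i < n" for c i
    proof -
      \<comment> \<open>Only the index set refers to the fixed \<open>c\<close>; in the summand the
        name is bound again.\<close>
      let ?s = "\<Oplus>c\<in>?X - {c}. c i \<otimes> u c"
      have mem: "c' i \<otimes> u c' \<in> carrier R" if "c' \<in> ?X" for c'
        using nonzero_vectors_closed[OF that i] uc[OF that] by simp
      have "?s \<in> P c"
        using PI[OF c] finite_nonzero_vectors u(3) nonzero_vectors_closed i c
        by (intro finsum_in_ideal ideal_mult) auto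
      moreover from this have "?s \<in> carrier R" using PI[OF c] ideal_carr by blast
      moreover have "b i = c i \<otimes> u c \<oplus> ?s"
      proof -
        have "b i = (\<Oplus>c\<in>insert c (?X - {c}). c i \<otimes> u c)" unfolding b_def using c by (simp add: insert_absorb)
        also have "\<dots> = c i \<otimes> u c \<oplus> ?s"
          using finite_nonzero_vectors mem c by (intro finsum_insert) auto
        finally show ?thesis .
      qed
      moreover have "(x \<oplus> y) \<ominus> x = y" if "x \<in> carrier R" "y \<in> carrier R" for x y
        using that by algebra
      ultimately show ?thesis using mem[OF c] by simp
    qed
  qed (use Pco u uc in auto)
qed

section \<open>Generators in general position\<close>

text \<open>The chain \<open>F\<close> ending in \<open>Q\<close> expresses that \<open>Q\<close>
  has height at least \<open>k\<close>. The next element is chosen in its coset outside the finitely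
  many primes covering the previous ideal, apart from \<open>m\<close> and the members of
  \<open>Z\<close>.\<close>

lemma exists_parameters:
  assumes Z: "finite Z" "Z \<noteq> {}" "Z \<subseteq> coheight_one" and b: "\<And>i. i < k \<Longrightarrow> b i \<in> carrier R"
  shows "\<exists>a. (\<forall>i<k. a i \<in> carrier R \<and> a i \<ominus> b i \<in> \<Inter> Z) \<and>
    (\<forall>Q. primeideal Q R \<longrightarrow> Q \<noteq> m \<longrightarrow> Q \<notin> Z \<longrightarrow> a ` {..<k} \<subseteq> Q \<longrightarrow>
      (\<exists>F. (\<forall>i\<le>k. primeideal (F i) R) \<and> (\<forall>i<k. F i \<subset> F (Suc i)) \<and> F k = Q))"
  using b
proof (induction k)
  case 0
  show ?case by auto
next
  case (Suc k)
  have Xp: "primeideal P R" if "P \<in> Z" for P using that Z(3) unfolding coheight_one_def by blast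
  have above: "Q = P \<or> Q = m" if "P \<in> Z" "primeideal Q R" "P \<subseteq> Q" for P Q
    using that Z(3) unfolding coheight_one_def by blast
  have K: "ideal (\<Inter> Z) R" using i_Intersect[of Z] Z(2) Xp prime_ideal by blast
  obtain a where a: "\<forall>i<k. a i \<in> carrier R \<and> a i \<ominus> b i \<in> \<Inter> Z"
    "\<And>Q. primeideal Q R \<Longrightarrow> Q \<noteq> m \<Longrightarrow> Q \<notin> Z \<Longrightarrow> a ` {..<k} \<subseteq> Q \<Longrightarrow>
      \<exists>F. (\<forall>i\<le>k. primeideal (F i) R) \<and> (\<forall>i<k. F i \<subset> F (Suc i)) \<and> F k = Q"
    using Suc.IH Suc.prems less_Suc_eq by (metis (no_types, lifting))
  have ac: "a ` {..<k} \<subseteq> carrier R" using a(1) by auto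
  obtain A where A: "finite A" "\<And>Q. Q \<in> A \<Longrightarrow> primeideal Q R \<and> Idl\<^bsub>R\<^esub> (a ` {..<k}) \<subseteq> Q"
    "\<And>P. primeideal P R \<Longrightarrow> Idl\<^bsub>R\<^esub> (a ` {..<k}) \<subseteq> P \<Longrightarrow> \<exists>Q\<in>A. Q \<subseteq> P"
    using finite_prime_cover[OF genideal_ideal[OF ac]] by metis
  let ?A = "{Q \<in> A. Q \<noteq> m \<and> Q \<notin> Z}"
  \<comment> \<open>A prime over a finite intersection contains one of its members; by coheight one
    it is that member or \<open>m\<close>, both excluded.\<close>
  have "\<not> \<Inter> Z \<subseteq> Q" if Q: "Q \<in> ?A" for Q
  proof
    assume sub: "\<Inter> Z \<subseteq> Q"
    have Qp: "primeideal Q R" using A(2) Q by blast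
    have "\<not> P \<subseteq> Q" if "P \<in> Z" for P using above[OF that Qp] Q that by blast
    then obtain z where "\<And>P. P \<in> Z \<Longrightarrow> z \<in> P" "z \<notin> Q"
      using prime_avoids_ideals[OF Z(1) prime_ideal[OF Xp] Qp] by blast
    then show False using sub by blast
  qed
  then obtain w where w: "w \<in> \<Inter> Z" "\<forall>Q\<in>?A. b k \<oplus> w \<notin> Q"
    using coset_prime_avoidance[of ?A "\<Inter> Z" "b k"] A(1,2) K Suc.prems[of k] by auto
  define a' where "a' = a(k := b k \<oplus> w)"
  have "w \<in> carrier R" using w K ideal_carr by blast
  moreover from this have "(b k \<oplus> w) \<ominus> b k = w" using Suc.prems[OF lessI] by algebra
  ultimately have "\<forall>i<Suc k. a' i \<in> carrier R \<and> a' i \<ominus> b i \<in> \<Inter> Z"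
    using a(1) w(1) Suc.prems[of k] by (auto simp: a'_def less_Suc_eq simp del: Inter_iff)
  moreover have "\<exists>F. (\<forall>i\<le>Suc k. primeideal (F i) R) \<and> (\<forall>i<Suc k. F i \<subset> F (Suc i)) \<and> F (Suc k) = Q"
    if Q: "primeideal Q R" "Q \<noteq> m" "Q \<notin> Z" "a' ` {..<Suc k} \<subseteq> Q" for Q
  proof -
    have aQ: "a ` {..<k} \<subseteq> Q" "b k \<oplus> w \<in> Q" using Q(4) by (auto simp: a'_def image_subset_iff less_Suc_eq)
    obtain Q' where Q': "Q' \<in> A" "Q' \<subseteq> Q"
      using A(3)[OF Q(1) genideal_minimal[OF prime_ideal[OF Q(1)] aQ(1)]] by blast
    have Q'p: "primeideal Q' R" "a ` {..<k} \<subseteq> Q'" using A(2)[OF Q'(1)] genideal_self[OF ac] by auto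
    have "Q' \<noteq> m" using Q' prime_subset_m[OF Q(1)] Q(2) by blast
    \<comment> \<open>A member of \<open>Z\<close> has only itself and \<open>m\<close> above it,
      and \<open>Q\<close> is neither in \<open>Z\<close> nor equal to \<open>m\<close>.\<close>
    moreover have "Q' \<notin> Z" using above[of Q' Q] Q Q' by blast
    ultimately obtain F where F: "\<forall>i\<le>k. primeideal (F i) R" "\<forall>i<k. F i \<subset> F (Suc i)" "F k = Q'"
      using a(2)[OF Q'p(1) _ _ Q'p(2)] by blast
    \<comment> \<open>The new element lies in \<open>Q\<close> and was chosen outside
      \<open>Q'\<close>.\<close>
    have "Q' \<subset> Q" using w(2) Q' aQ(2) \<open>Q' \<noteq> m\<close> \<open>Q' \<notin> Z\<close> by blast
    then show ?thesis using F Q(1)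
      by (intro exI[of _ "F(Suc k := Q)"]) (auto simp: less_Suc_eq le_Suc_eq)
  qed
  ultimately show ?case by blast
qed

text \<open>The absence of chains of length \<open>n + 1\<close> stands for
  \<open>n \<ge> dim R\<close>: a prime over \<open>I\<close> other than \<open>m\<close> would end
  a chain of length \<open>n\<close>, which \<open>m\<close> prolongs.\<close>

lemma exists_ideal_without_proper_reduction:
  assumes "infinite coheight_one" "0 < n"
  shows "\<exists>I. ideal I R \<and> minimally_generated_by R I n \<and> \<not> has_proper_reduction R I
    \<and> (\<not> has_prime_chain R (Suc n) \<longrightarrow> primary_to R m I)"
proof -
  obtain P u b where P: "\<And>c. c \<in> nonzero_vectors n \<Longrightarrow> P c \<in> coheight_one"
    and u: "\<And>c. c \<in> nonzero_vectors n \<Longrightarrow> u c \<in> carrier R" "\<And>c. c \<in> nonzero_vectors n \<Longrightarrow> u c \<notin> P c"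
    and b: "\<And>i. i < n \<Longrightarrow> b i \<in> m"
    "\<And>c i. c \<in> nonzero_vectors n \<Longrightarrow> i < n \<Longrightarrow> b i \<ominus> c i \<otimes> u c \<in> P c"
    using exists_interpolating_primes[OF assms(1)] by metis
  let ?X = "P ` nonzero_vectors n"
  have bc: "b i \<in> carrier R" if "i < n" for i using b(1)[OF that] ideal_carr[OF m_ideal] by blast
  have Pp: "primeideal (P c) R" if "c \<in> nonzero_vectors n" for c
    using P[OF that] unfolding coheight_one_def by blast
  have "rep \<one> \<notin> m"
    using rep_zero_iff[OF rep_closed[OF one_closed]] rep_rep[OF one_closed] rep_zero_iff[OF one_closed]
      one_notin_prime[OF m_prime] by simp
  \<comment> \<open>The all-ones vector, nonzero as \<open>n\<close> is positive, supplies an index;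
    thus the intersection of the primes \<open>P c\<close> lies in a prime and so in
    \<open>m\<close>.\<close>
  then have e: "(\<lambda>i\<in>{..<n}. rep \<one>) \<in> nonzero_vectors n"
    unfolding nonzero_vectors_def using assms(2) by auto
  have "finite ?X" "?X \<noteq> {}" "?X \<subseteq> coheight_one" using finite_nonzero_vectors P e by auto
  from exists_parameters[OF this, of n b, OF bc]
  obtain a where *: "(\<forall>i<n. a i \<in> carrier R \<and> a i \<ominus> b i \<in> \<Inter> ?X) \<and>
      (\<forall>Q. primeideal Q R \<longrightarrow> Q \<noteq> m \<longrightarrow> Q \<notin> ?X \<longrightarrow> a ` {..<n} \<subseteq> Q \<longrightarrow>
        (\<exists>F. (\<forall>i\<le>n. primeideal (F i) R) \<and> (\<forall>i<n. F i \<subset> F (Suc i)) \<and> F n = Q))"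
    by (rule exE)
  note a = *[THEN conjunct1, rule_format] and chain = *[THEN conjunct2, rule_format]
  have acong: "a i \<ominus> c i \<otimes> u c \<in> P c" if "c \<in> nonzero_vectors n" "i < n" for c i
    using ideal_cong_trans[OF prime_ideal[OF Pp[OF that(1)]] _ b(2)[OF that]] a[OF that(2)] that
      bc[OF that(2)] u(1)[OF that(1)] nonzero_vectors_closed[OF that] by simp
  interpret rational_point_ideal R m n P u a
    using finite_residue_local_ring_axioms
    by (intro rational_point_ideal.intro rational_point_ideal_axioms.intro)
      (simp_all add: Pp u a acong)
  have "I \<subseteq> m"
  proof (rule I_subset[OF m_ideal])
    fix i assume i: "i < n"
    have "a i \<ominus> b i \<in> m" using a[OF i] e prime_subset_m[OF Pp[OF e]] by blast
    then show "a i \<in> m" using ideal_cong_mem_iff[OF m_ideal] a[OF i] b(1)[OF i] bc[OF i] by blast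
  qed
  moreover have "Q = m" if no: "\<not> has_prime_chain R (Suc n)" and Q: "primeideal Q R" "I \<subseteq> Q" for Q
  proof (rule ccontr)
    assume Qm: "Q \<noteq> m"
    have aQ: "a ` {..<n} \<subseteq> Q" using a_in_I Q(2) by blast
    \<comment> \<open>No \<open>P c\<close> contains \<open>I\<close>: where \<open>c i\<close> is
      outside \<open>m\<close>, neither factor of \<open>c i * u c\<close> lies in
      \<open>P c\<close>.\<close>
    have "Q \<notin> ?X"
    proof
      assume "Q \<in> ?X"
      then obtain c where c: "c \<in> nonzero_vectors n" "Q = P c" by blast
      then obtain i where i: "i < n" "c i \<notin> m" unfolding nonzero_vectors_def by blast
      have cc: "c i \<in> carrier R" using nonzero_vectors_closed[OF c(1) i(1)] .
      have "c i \<otimes> u c \<in> P c"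
        using ideal_cong_mem_iff[OF prime_ideal[OF Pp[OF c(1)]] acong[OF c(1) i(1)]] 
          a[OF i(1)] aQ c i(1) cc u(1)[OF c(1)] by auto
      then show False
        using prime_dest[OF Pp[OF c(1)] cc u(1)[OF c(1)]] u(2)[OF c(1)] i(2) 
          prime_subset_m[OF Pp[OF c(1)]] by blast
    qed
    then obtain F where F: "\<forall>i\<le>n. primeideal (F i) R" "\<forall>i<n. F i \<subset> F (Suc i)" "F n = Q"
      using chain[OF Q(1) Qm _ aQ] by blast
    moreover have "Q \<subset> m" using prime_subset_m[OF Q(1)] Qm by blast
    ultimately have "has_prime_chain R (Suc n)"
      unfolding has_prime_chain_def using m_prime
      by (intro exI[of _ "F(Suc n := m)"]) (auto simp: less_Suc_eq le_Suc_eq)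
    then show False using no by blast
  qed
  ultimately show ?thesis
    using I_ideal minimally_generated no_proper_reduction primary_to_m[OF I_ideal] by blast
qed

end

section \<open>From the Krull dimension to chains of primes\<close>

lemma has_prime_chain_mono:
  assumes "has_prime_chain R n" "k \<le> n"
  shows "has_prime_chain R k"
  using assms unfolding has_prime_chain_def by (meson le_trans less_le_trans)

theorem theorem3p8:
  fixes R :: "('a, 'b) ring_scheme" and m :: "'a set" and d :: nat
  assumes "noetherian_ring R"
    and "local_ring_with R m"
    and "krull_dim R = enat d"
    and "d \<ge> 2"
    and "finite (carrier (R Quot m))"
  shows "\<forall>n::nat. n > 0 \<longrightarrow>
           (\<exists>I. ideal I R \<and> minimally_generated_by R I n \<and> \<not> has_proper_reduction R I
                \<and> (n \<ge> d \<longrightarrow> primary_to R m I))"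
proof -
  have loc: "cring R" "maximalideal m R" "\<And>M. maximalideal M R \<Longrightarrow> M = m"
    using assms(2) unfolding local_ring_with_def by simp_all
  interpret finite_residue_local_ring R m
    by (intro finite_residue_local_ring.intro noetherian_local_ring.intro noetherian_cring.intro
        noetherian_local_ring_axioms.intro finite_residue_local_ring_axioms.intro assms(1,5) loc)
  have "has_prime_chain R 2"
  proof (rule ccontr)
    assume no: "\<not> has_prime_chain R 2"
    have "enat n \<le> enat 1" if "has_prime_chain R n" for n
      using has_prime_chain_mono[OF that, of 2] no by (cases "2 \<le> n") auto
    then have "krull_dim R \<le> enat 1" unfolding krull_dim_def by (intro SUP_least) blast
    then show False using assms(3,4) by simp
  qed
  then have inf: "infinite coheight_one" by (rule infinite_coheight_one)
  have long: "\<not> has_prime_chain R (Suc n)" if "d \<le> n" for n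
  proof
    assume "has_prime_chain R (Suc n)"
    then have "enat (Suc n) \<le> krull_dim R" unfolding krull_dim_def by (intro SUP_upper) blast
    then show False using assms(3) that by simp
  qed
  show ?thesis
    using exists_ideal_without_proper_reduction[OF inf] long by meson
qed

end
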